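(* Let $N \in \mathbb N$, $N\ge 1$, and let $L_0 > \bar L_0 = \frac12 e^{2+\gamma}$. There exists $\bar\delta_0 > 0$ (depending only on $N$ and $L_0$) such that for any fixed points $\mathbf r_1,\dots,\mathbf r_N \in \mathbb R^2$ and all $\bar\delta > 0$ and $\bar\kappa\in\mathbb R$ with $\bar\delta < \bar\delta_0$ and $|\bar\kappa| < \bar\delta_0$, there exists a minimizer of the problem $$\min \left\{ F_N(\{\rho_n,\theta_n,\mathbf r_n\}) : \ \rho_n \in (0, L_0^{-1}),\ \theta_n \in [-\pi,\pi),\ n = 1,\dots,N \right\},$$ i.e., the infimum of $F_N$ over all radii $\rho_n\in(0,L_0^{-1})$ and angles $\theta_n\in[-\pi,\pi)$, with the positions $\mathbf r_n$ held fixed, is attained.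
   Context: Here $\gamma$ is the Euler–Mascheroni constant. $J_0$ is the Bessel function of the first kind of order $0$; $K_0, K_1$ are the modified Bessel functions of the second kind of orders $0$ and $1$. For $\alpha > 0$ and $\lambda \geq 0$ define $$F_{vv}(\alpha,\lambda) = \frac{32}{3\pi^2}\int_0^\infty \xi^2 J_0(\lambda\xi) K_1(\alpha\xi)K_1(\xi/\alpha)\,d\xi,$$ $$F_{ss}(\alpha,\lambda) = \frac{32}{\pi^2}\int_0^\infty \xi^2 J_0(\lambda\xi) K_0(\alpha\xi)K_0(\xi/\alpha)\,d\xi,$$ $$F_{vs}(\alpha,\lambda) = 2\int_0^\infty \xi^2 J_0(\lambda\xi) K_0(\alpha\xi)K_1(\xi/\alpha)\,d\xi.$$ For parameters $\bar\delta>0$, $\bar\kappa\in\mathbb R$, and for $\rho_n > 0$, $\theta_n\in[-\pi,\pi)$, $\mathbf r_n\in\mathbb R^2$ ($n=1,\dots,N$), the energy function (in zero applied field) is $$\begin{aligned} F_N(\{\rho_n,\theta_n,\mathbf r_n\}) &= \sum_{n=1}^N\left[-4\pi\rho_n^2\ln\left(\frac{e^{1+2\gamma}}{4}\rho_n^2\right) - 8\pi\bar\kappa\rho_n\cos\theta_n + \bar\delta\,\frac{\pi^3}{8}\rho_n(3\cos^2\theta_n - 1)\right]\\ &+\sum_{n=1}^{N-1}\sum_{k=n+1}^N \bar\delta\,\frac{\pi^3}{4}\sqrt{\rho_n\rho_k}\left[3\cos\theta_n\cos\theta_k\,F_{vv}(\alpha_{nk},\lambda_{nk}) - F_{ss}(\alpha_{nk},\lambda_{nk})\right]\\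 &-\sum_{n=1}^{N-1}\sum_{k=n+1}^N 4\pi\bar\delta\sqrt{\rho_n\rho_k}\left[\cos\theta_n\,F_{vs}(\alpha_{nk},\lambda_{nk}) - \cos\theta_k\,F_{vs}(\alpha_{nk}^{-1},\lambda_{nk})\right], \end{aligned}$$ where $\alpha_{nk} = \sqrt{\rho_k/\rho_n}$ and $\lambda_{nk} = |\mathbf r_n-\mathbf r_k|/\sqrt{\rho_n\rho_k}$. *)

theory Defs
  imports "HOL-Analysis.Analysis"
begin

definition bessel_J :: "nat \<Rightarrow> real \<Rightarrow> real" where
  "bessel_J \<nu> x = (\<Sum>k. (-1) ^ k / (fact k * fact (k + \<nu>)) * (x / 2) ^ (2 * k + \<nu>))"

(* The classical integral representation of the modified Bessel function of the
   second kind, valid for x > 0, the only arguments that occur below.  (For x <= 0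
   the integrand is not integrable and the Bochner integral has the value 0.) *)
definition bessel_K :: "nat \<Rightarrow> real \<Rightarrow> real" where
  "bessel_K \<nu> x = (LINT t:{0<..}|lborel. exp (- x * cosh t) * cosh (real \<nu> * t))"

(* For \<alpha> > 0 the following three integrands are absolutely integrable on (0, \<infinity>):
   K_0 is logarithmic and K_1 is of order 1/\<xi> at 0, both decay exponentially at
   infinity, and J_0 is bounded. *)

definition F_vv :: "real \<Rightarrow> real \<Rightarrow> real" where
  "F_vv \<alpha> l = 32 / (3 * pi\<^sup>2) *
     (LINT \<xi>:{0<..}|lborel. \<xi>\<^sup>2 * bessel_J 0 (l * \<xi>) * bessel_K 1 (\<alpha> * \<xi>) * bessel_K 1 (\<xi> / \<alpha>))"

definition F_ss :: "real \<Rightarrow> real \<Rightarrow> real" where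
  "F_ss \<alpha> l = 32 / pi\<^sup>2 *
     (LINT \<xi>:{0<..}|lborel. \<xi>\<^sup>2 * bessel_J 0 (l * \<xi>) * bessel_K 0 (\<alpha> * \<xi>) * bessel_K 0 (\<xi> / \<alpha>))"

definition F_vs :: "real \<Rightarrow> real \<Rightarrow> real" where
  "F_vs \<alpha> l = 2 *
     (LINT \<xi>:{0<..}|lborel. \<xi>\<^sup>2 * bessel_J 0 (l * \<xi>) * bessel_K 0 (\<alpha> * \<xi>) * bessel_K 1 (\<xi> / \<alpha>))"

definition pair_alpha :: "(nat \<Rightarrow> real) \<Rightarrow> nat \<Rightarrow> nat \<Rightarrow> real" where
  "pair_alpha \<rho> n k = sqrt (\<rho> k / \<rho> n)"

definition pair_lambda :: "(nat \<Rightarrow> real) \<Rightarrow> (nat \<Rightarrow> real ^ 2) \<Rightarrow> nat \<Rightarrow> nat \<Rightarrow> real" where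
  "pair_lambda \<rho> r n k = norm (r n - r k) / sqrt (\<rho> n * \<rho> k)"

(* Families indexed by n = 1, ..., N are functions on nat, of which only the
   values on {1..N} are used. *)
definition energy ::
  "real \<Rightarrow> real \<Rightarrow> nat \<Rightarrow> (nat \<Rightarrow> real) \<Rightarrow> (nat \<Rightarrow> real) \<Rightarrow> (nat \<Rightarrow> real ^ 2) \<Rightarrow> real"
where
  "energy \<delta> \<kappa> N \<rho> \<theta> r =
     (\<Sum>n=1..N.
        - 4 * pi * (\<rho> n)\<^sup>2 * ln (exp (1 + 2 * euler_mascheroni) / 4 * (\<rho> n)\<^sup>2)
        - 8 * pi * \<kappa> * \<rho> n * cos (\<theta> n)
        + \<delta> * (pi ^ 3 / 8) * \<rho> n * (3 * (cos (\<theta> n))\<^sup>2 - 1))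
   + (\<Sum>n=1..N-1. \<Sum>k=n+1..N.
        \<delta> * (pi ^ 3 / 4) * sqrt (\<rho> n * \<rho> k) *
        (3 * cos (\<theta> n) * cos (\<theta> k) * F_vv (pair_alpha \<rho> n k) (pair_lambda \<rho> r n k)
         - F_ss (pair_alpha \<rho> n k) (pair_lambda \<rho> r n k)))
   - (\<Sum>n=1..N-1. \<Sum>k=n+1..N.
        4 * pi * \<delta> * sqrt (\<rho> n * \<rho> k) *
        (cos (\<theta> n) * F_vs (pair_alpha \<rho> n k) (pair_lambda \<rho> r n k)
         - cos (\<theta> k) * F_vs (inverse (pair_alpha \<rho> n k)) (pair_lambda \<rho> r n k)))"

definition admissible :: "real \<Rightarrow> nat \<Rightarrow> (nat \<Rightarrow> real) \<Rightarrow> (nat \<Rightarrow> real) \<Rightarrow> bool" where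
  "admissible L\<^sub>0 N \<rho> \<theta> \<longleftrightarrow>
     (\<forall>n\<in>{1..N}. \<rho> n \<in> {0<..<inverse L\<^sub>0} \<and> \<theta> n \<in> {-pi..<pi})"

end

theory Submission
  imports Defs "HOL-Real_Asymp.Real_Asymp"
begin

text \<open>Since \<open>K\<^sub>0 \<le> K\<^sub>1 \<le> min (1/x) (4/x\<^sup>2)\<close> and \<open>\<bar>J\<^sub>0\<bar> \<le> 1\<close>, the interaction integrals are bounded and
  continuous, so with the prefactor \<open>sqrt (\<rho>\<^sub>n \<rho>\<^sub>k)\<close> the energy extends continuously to radii in
  \<open>[0, 1/L\<^sub>0]\<close>, where it attains its minimum. A vanishing radius \<open>\<rho>\<^sub>n\<close> is not optimal: for
  \<open>\<theta>\<^sub>n = \<plusminus>\<pi>/2\<close> all interactions are \<open>o(\<rho>\<^sub>n)\<close>, while the anisotropy contributes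
  \<open>- \<delta> \<pi>\<^sup>3 \<rho>\<^sub>n / 8\<close>. A radius \<open>1/L\<^sub>0\<close> is not optimal either: on \<open>[0, 1/L\<^sub>0]\<close> the logarithmic term is at least
  \<open>12 \<pi> \<rho>\<^sub>n\<^sup>2\<close>, all other terms are \<open>O(\<delta> + \<bar>\<kappa>\<bar>)\<close>, and the energy vanishes when all radii do.\<close>

subsection \<open>The Bessel function of the first kind\<close>

text \<open>J_0 as a power series in y = x^2/4. This variable removes the gaps in the series and
  turns Bessel's equation into y g'' + g' + g = 0.\<close>

definition bessel_J0_series :: "real \<Rightarrow> real" where
  "bessel_J0_series y = (\<Sum>n. (-1) ^ n / (fact n)\<^sup>2 * y ^ n)"

lemma bessel_J_0_eq: "bessel_J 0 x = bessel_J0_series (x\<^sup>2 / 4)"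
  unfolding bessel_J_def bessel_J0_series_def
  by (intro suminf_cong) (simp add: power_mult power_divide power2_eq_square)

lemma summable_bessel_J0_series: "summable (\<lambda>n. (-1) ^ n / (fact n)\<^sup>2 * y ^ n :: real)"
proof (rule summable_comparison_test')
  show "summable (\<lambda>n. inverse (fact n) * \<bar>y\<bar> ^ n)"
    by (rule summable_exp)
  fix n :: nat
  have "inverse ((fact n)\<^sup>2) \<le> inverse (fact n :: real)"
    by (intro le_imp_inverse_le) (auto simp: power2_eq_square)
  then show "norm ((-1) ^ n / (fact n)\<^sup>2 * y ^ n) \<le> inverse (fact n) * \<bar>y\<bar> ^ n"
    by (simp add: abs_mult power_abs divide_inverse mult_right_mono)
qed

text \<open>Comparison of coefficients: c_n = (-1)^n/(n!)^2 satisfies (n+1)^2 c_(n+1) + c_n = 0, and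
  the series converges everywhere, so it may be differentiated termwise.\<close>

lemma bessel_J0_series_ode:
  obtains g' g'' where
    "\<And>y. (bessel_J0_series has_real_derivative g' y) (at y)"
    "\<And>y. (g' has_real_derivative g'' y) (at y)"
    "\<And>y. y * g'' y + g' y + bessel_J0_series y = 0"
proof
  define c :: "nat \<Rightarrow> real" where "c = (\<lambda>n. (-1) ^ n / (fact n)\<^sup>2)"
  define g' where "g' = (\<lambda>y. \<Sum>n. diffs c n * y ^ n)"
  define g'' where "g'' = (\<lambda>y. \<Sum>n. diffs (diffs c) n * y ^ n)"
  have c: "summable (\<lambda>n. c n * y ^ n)" for y
    using summable_bessel_J0_series by (simp add: c_def)
  have c': "summable (\<lambda>n. diffs c n * y ^ n)" for y
    by (rule termdiff_converges_all[OF c])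
  have c'': "summable (\<lambda>n. diffs (diffs c) n * y ^ n)" for y
    by (rule termdiff_converges_all[OF c'])
  have g: "bessel_J0_series = (\<lambda>y. \<Sum>n. c n * y ^ n)"
    by (simp add: fun_eq_iff bessel_J0_series_def c_def)
  show "(bessel_J0_series has_real_derivative g' y) (at y)" for y
    unfolding g g'_def by (rule termdiffs_strong_converges_everywhere[OF c])
  show "(g' has_real_derivative g'' y) (at y)" for y
    unfolding g'_def g''_def by (rule termdiffs_strong_converges_everywhere[OF c'])
  fix y :: real
  have "(\<lambda>n. diffs (diffs c) n * y ^ n * y) sums (g'' y * y)"
    unfolding g''_def by (intro sums_mult2 summable_sums c'')
  \<comment> \<open>The factor y shifts the index by one; the term at m = 0 vanishes, so the shifted
    series can start at 0 again.\<close>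
  then have "(\<lambda>n. (\<lambda>m. real m * diffs c m * y ^ m) (Suc n)) sums (g'' y * y)"
    by (simp add: diffs_def algebra_simps)
  then have "(\<lambda>m. real m * diffs c m * y ^ m) sums (g'' y * y)"
    by (subst (asm) sums_Suc_iff) simp
  moreover have "(\<lambda>n. diffs c n * y ^ n) sums g' y" "(\<lambda>n. c n * y ^ n) sums bessel_J0_series y"
    unfolding g'_def g by (intro summable_sums c c')+
  ultimately have "(\<lambda>n. real n * diffs c n * y ^ n + diffs c n * y ^ n + c n * y ^ n)
      sums (g'' y * y + g' y + bessel_J0_series y)"
    by (intro sums_add)
  moreover have "real n * diffs c n * y ^ n + diffs c n * y ^ n + c n * y ^ n = 0" for n
  proof -
    have "(real n + 1) * diffs c n + c n = 0"
      by (simp add: c_def diffs_def divide_simps power2_eq_square)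
    then have "((real n + 1) * diffs c n + c n) * y ^ n = 0" by simp
    then show ?thesis by (simp add: algebra_simps)
  qed
  ultimately show "y * g'' y + g' y + bessel_J0_series y = 0"
    using sums_unique2[OF _ sums_zero] by (simp add: mult.commute)
qed

lemma isCont_bessel_J_0: "isCont (bessel_J 0) x"
proof -
  obtain g' g'' where "\<And>y. (bessel_J0_series has_real_derivative g' y) (at y)"
    using bessel_J0_series_ode by metis
  then have *: "isCont bessel_J0_series y" for y
    using DERIV_isCont by blast
  have "isCont (\<lambda>x. bessel_J0_series (x\<^sup>2 / 4)) x"
    by (intro isCont_o2[OF _ *] continuous_intros) auto
  then show ?thesis
    by (simp add: bessel_J_0_eq[abs_def])
qed

text \<open>By the differential equation, \<open>g\<^sup>2 + y g'\<^sup>2\<close> has derivative \<open>- g'\<^sup>2\<close> and is thus decreasing.\<close>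
lemma abs_bessel_J_0_le_1: "\<bar>bessel_J 0 x\<bar> \<le> 1"
proof -
  obtain g' g'' where d: "\<And>y. (bessel_J0_series has_real_derivative g' y) (at y)"
    "\<And>y. (g' has_real_derivative g'' y) (at y)"
    and ode: "\<And>y. y * g'' y + g' y + bessel_J0_series y = 0"
    using bessel_J0_series_ode by metis
  define E where "E = (\<lambda>y. (bessel_J0_series y)\<^sup>2 + y * (g' y)\<^sup>2)"
  define y where "y = x\<^sup>2 / 4"
  have "y \<ge> 0" by (simp add: y_def)
  have "(E has_real_derivative - (g' z)\<^sup>2) (at z)" for z
  proof -
    have "(E has_real_derivative
        2 * bessel_J0_series z * g' z + ((g' z)\<^sup>2 + z * (2 * g' z * g'' z))) (at z)"
      unfolding E_def by (auto intro!: derivative_eq_intros d simp: algebra_simps)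
    moreover have "bessel_J0_series z = - (z * g'' z) - g' z"
      using ode[of z] by simp
    ultimately show ?thesis
      by (simp add: algebra_simps power2_eq_square)
  qed
  then have "E y \<le> E 0"
    using \<open>y \<ge> 0\<close> by (intro DERIV_nonpos_imp_nonincreasing[of 0 y E]) (auto intro!: exI)
  moreover have "bessel_J0_series 0 = 1"
    using powser_zero[of "\<lambda>n. (-1) ^ n / (fact n)\<^sup>2 :: real"] by (simp only: bessel_J0_series_def) simp
  moreover have "y * (g' y)\<^sup>2 \<ge> 0" using \<open>y \<ge> 0\<close> by simp
  ultimately have "(bessel_J 0 x)\<^sup>2 \<le> 1"
    by (simp add: E_def bessel_J_0_eq flip: y_def)
  then show ?thesis by (simp add: abs_square_le_1)
qed

subsection \<open>Modified Bessel functions of the second kind\<close>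

text \<open>Only the orders 0 and 1 occur; \<nu> \<le> 1 treats both with the common majorant cosh
  t.\<close>

lemma cosh_of_nat_mult_le:
  fixes t :: real
  assumes "\<nu> \<le> 1"
  shows "cosh (real \<nu> * t) \<le> cosh t"
  using assms cosh_real_ge_1[of t] by (cases "\<nu> = 0") (auto simp: le_Suc_eq)

text \<open>For a nonnegative integrand, limits of an antiderivative at both ends already give
  integrability. This serves the three explicit integrals used as majorants.\<close>

lemma integral_Ioi_FTC:
  fixes f F :: "real \<Rightarrow> real"
  assumes D: "\<And>x. x > 0 \<Longrightarrow> (F has_real_derivative f x) (at x)"
    and cont: "\<And>x. x > 0 \<Longrightarrow> isCont f x"
    and nonneg: "\<And>x. x > 0 \<Longrightarrow> f x \<ge> 0"
    and lim0: "(F \<longlongrightarrow> A) (at_right 0)"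
    and lim: "(F \<longlongrightarrow> B) at_top"
  shows "set_integrable lborel {0<..} f"
    and "(LINT x:{0<..}|lborel. f x) = B - A"
proof -
  have ei: "einterval 0 \<infinity> = {0<..}"
    by (auto simp: einterval_def zero_ereal_def)
  have A: "((F \<circ> real_of_ereal) \<longlongrightarrow> A) (at_right 0)"
    using lim0 by (simp add: ereal_tendsto_simps zero_ereal_def)
  have B: "((F \<circ> real_of_ereal) \<longlongrightarrow> B) (at_left \<infinity>)"
    using lim by (simp add: ereal_tendsto_simps)
  have "AE x in lborel. 0 < ereal x \<longrightarrow> ereal x < \<infinity> \<longrightarrow> 0 \<le> f x"
    by (intro AE_I2) (simp add: nonneg)
  note FTC = interval_integral_FTC_nonneg[of 0 \<infinity> F f, OF _ _ _ this A B]
  show "set_integrable lborel {0<..} f"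
    using FTC(1) unfolding ei by (simp add: D cont)
  have "(LBINT x=0..\<infinity>. f x) = B - A"
    using FTC(2) by (simp add: D cont)
  then show "(LINT x:{0<..}|lborel. f x) = B - A"
    by (simp add: interval_lebesgue_integral_def ei)
qed

text \<open>The substitution u = sinh t reduces this to the integral of exp(-x u). It is the
  majorant for both K_0 and K_1.\<close>

lemma integral_exp_sinh_cosh:
  fixes x :: real
  assumes "x > 0"
  shows "set_integrable lborel {0<..} (\<lambda>t. exp (- x * sinh t) * cosh t)"
    and "(LINT t:{0<..}|lborel. exp (- x * sinh t) * cosh t) = 1 / x"
proof -
  have lim: "((\<lambda>t. - exp (- x * sinh t) / x) \<longlongrightarrow> 0) at_top"
  proof -
    have "filterlim (\<lambda>t::real. x * sinh t) at_top at_top"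
      by (intro filterlim_tendsto_pos_mult_at_top[OF tendsto_const assms] sinh_real_at_top)
    then have "((\<lambda>t. exp (- (x * sinh t))) \<longlongrightarrow> 0) at_top"
      by (intro filterlim_compose[OF exp_at_bot] filterlim_compose[OF filterlim_uminus_at_bot_at_top])
    then have "((\<lambda>t. - exp (- (x * sinh t)) / x) \<longlongrightarrow> - 0 / x) at_top"
      by (intro tendsto_intros) (use assms in auto)
    then show ?thesis by simp
  qed
  have lim0: "((\<lambda>t. - exp (- x * sinh t) / x) \<longlongrightarrow> - 1 / x) (at_right 0)"
  proof -
    have "isCont (\<lambda>t. - exp (- x * sinh t) / x) 0"
      using assms by (intro continuous_intros) auto
    then show ?thesis
      by (simp add: isCont_def filterlim_at_split)
  qed
  have D: "((\<lambda>t. - exp (- x * sinh t) / x) has_real_derivative exp (- x * sinh t) * cosh t) (at t)" for t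
    using assms by (auto intro!: derivative_eq_intros)
  have C: "isCont (\<lambda>t. exp (- x * sinh t) * cosh t) t" for t
    by (intro continuous_intros)
  note FTC = integral_Ioi_FTC[OF D C _ lim0 lim]
  show "set_integrable lborel {0<..} (\<lambda>t. exp (- x * sinh t) * cosh t)"
    by (rule FTC(1)) simp
  show "(LINT t:{0<..}|lborel. exp (- x * sinh t) * cosh t) = 1 / x"
    by (subst FTC(2)) simp_all
qed

lemma set_borel_measurable_continuous_Ioi:
  fixes f :: "real \<Rightarrow> real"
  assumes "continuous_on {a<..} f"
  shows "set_borel_measurable lborel {a<..} f"
  unfolding set_borel_measurable_def
  using borel_measurable_continuous_on_indicator[OF _ assms] by simp

text \<open>sinh t \<le> cosh t weakens the exponent to one with an elementary integral. The lower
  bound c gives one majorant for all x \<ge> c, as dominated convergence requires.\<close>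

lemma bessel_K_integrand_le:
  assumes "\<nu> \<le> 1" "0 < c" "c \<le> x" "0 \<le> t"
  shows "exp (- x * cosh t) * cosh (real \<nu> * t) \<le> exp (- c * sinh t) * cosh t"
proof (intro mult_mono)
  have "c * sinh t \<le> x * cosh t"
    using assms sinh_le_cosh_real[of t] by (intro mult_mono) auto
  then show "exp (- x * cosh t) \<le> exp (- c * sinh t)" by simp
qed (use cosh_of_nat_mult_le[OF assms(1)] in auto)

lemma set_integrable_bessel_K:
  assumes "\<nu> \<le> 1" "x > 0"
  shows "set_integrable lborel {0<..} (\<lambda>t. exp (- x * cosh t) * cosh (real \<nu> * t))"
proof (rule set_integrable_bound[OF integral_exp_sinh_cosh(1)[OF assms(2)]])
  show "set_borel_measurable lborel {0<..} (\<lambda>t. exp (- x * cosh t) * cosh (real \<nu> * t))"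
    by (intro set_borel_measurable_continuous_Ioi continuous_intros)
qed (use bessel_K_integrand_le[OF assms order_refl] in auto)

lemma bessel_K_nonneg: "bessel_K \<nu> x \<ge> 0"
  unfolding bessel_K_def set_lebesgue_integral_def by (intro Bochner_Integration.integral_nonneg) auto

lemma bessel_K_le_inverse:
  assumes "\<nu> \<le> 1" "x > 0"
  shows "bessel_K \<nu> x \<le> 1 / x"
proof -
  have "bessel_K \<nu> x \<le> (LINT t:{0<..}|lborel. exp (- x * sinh t) * cosh t)"
    unfolding bessel_K_def
    by (intro set_integral_mono set_integrable_bessel_K integral_exp_sinh_cosh bessel_K_integrand_le
        assms order_refl) auto
  also have "\<dots> = 1 / x"
    by (rule integral_exp_sinh_cosh(2)[OF assms(2)])
  finally show ?thesis .
qed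

text \<open>cosh t \<ge> 1 lets half of the exponent leave the integral as exp(-x/2); what remains
  is K_\<nu>(x/2) \<le> 2/x.\<close>

lemma bessel_K_le_exp:
  assumes "\<nu> \<le> 1" "x > 0"
  shows "bessel_K \<nu> x \<le> 2 / x * exp (- x / 2)"
proof -
  have "bessel_K \<nu> x \<le> (LINT t:{0<..}|lborel. exp (- x / 2) * (exp (- (x / 2) * cosh t) * cosh (real \<nu> * t)))"
    unfolding bessel_K_def
  proof (intro set_integral_mono set_integrable_bessel_K set_integrable_mult_right)
    fix t :: real
    have "x / 2 * 1 \<le> x / 2 * cosh t"
      using assms cosh_real_ge_1[of t] by (intro mult_left_mono) auto
    then have "exp (- x * cosh t) \<le> exp (- x / 2 + - (x / 2) * cosh t)"
      by simp
    then show "exp (- x * cosh t) * cosh (real \<nu> * t)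
        \<le> exp (- x / 2) * (exp (- (x / 2) * cosh t) * cosh (real \<nu> * t))"
      unfolding exp_add mult.assoc[symmetric] by (intro mult_right_mono) auto
  qed (use assms in auto)
  also have "\<dots> = exp (- x / 2) * bessel_K \<nu> (x / 2)"
    by (simp add: bessel_K_def)
  also have "\<dots> \<le> exp (- x / 2) * (1 / (x / 2))"
    using assms by (intro mult_left_mono bessel_K_le_inverse) auto
  finally show ?thesis by (simp add: mult.commute)
qed

text \<open>The exponential decay is traded for powers through the quadratic Taylor bound of
  exp(x/2). The cube will compensate a second factor that is only bounded by x^(-1/2).\<close>

lemma bessel_K_le_inverse_power:
  assumes "\<nu> \<le> 1" "x > 0"
  shows "bessel_K \<nu> x \<le> 4 / x ^ 2" "bessel_K \<nu> x \<le> 16 / x ^ 3"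
proof -
  have e: "1 + x / 2 + (x / 2)\<^sup>2 / 2 \<le> exp (x / 2)"
    using assms by (intro exp_lower_Taylor_quadratic) auto
  have *: "bessel_K \<nu> x \<le> 2 / x * (1 / exp (x / 2))"
    using bessel_K_le_exp[OF assms] exp_minus_inverse[of "x / 2"] by (simp add: field_simps exp_minus)
  have "x / 2 \<le> exp (x / 2)"
    using e zero_le_power2[of "x / 2"] by linarith
  then have "1 / exp (x / 2) \<le> 1 / (x / 2)"
    using assms by (intro divide_left_mono) auto
  then have "2 / x * (1 / exp (x / 2)) \<le> 2 / x * (1 / (x / 2))"
    using assms by (intro mult_left_mono) auto
  with * show "bessel_K \<nu> x \<le> 4 / x ^ 2"
    by (simp add: power2_eq_square)
  have "x\<^sup>2 / 8 \<le> exp (x / 2)"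
    using e assms by (simp add: power2_eq_square)
  then have "1 / exp (x / 2) \<le> 1 / (x\<^sup>2 / 8)"
    using assms by (intro divide_left_mono) auto
  then have "2 / x * (1 / exp (x / 2)) \<le> 2 / x * (1 / (x\<^sup>2 / 8))"
    using assms by (intro mult_left_mono) auto
  with * show "bessel_K \<nu> x \<le> 16 / x ^ 3"
    by (simp add: power2_eq_square power3_eq_cube)
qed

section \<open>An inverse square root bound for K_0\<close>

lemma integral_exp_neg_half:
  "set_integrable lborel {0<..} (\<lambda>t::real. exp (- t / 2))"
  "(LINT t:{0<..}|lborel. exp (- t / 2)) = (2::real)"
proof -
  have lim: "((\<lambda>t::real. - 2 * exp (- t / 2)) \<longlongrightarrow> 0) at_top"
    by real_asymp
  have lim0: "((\<lambda>t::real. - 2 * exp (- t / 2)) \<longlongrightarrow> - 2) (at_right 0)"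
    by real_asymp
  have D: "((\<lambda>t. - 2 * exp (- t / 2)) has_real_derivative exp (- t / 2)) (at t)" for t :: real
    by (auto intro!: derivative_eq_intros)
  have C: "isCont (\<lambda>t. exp (- t / 2)) t" for t :: real
    by (intro continuous_intros) auto
  note FTC = integral_Ioi_FTC[OF D C _ lim0 lim]
  show "set_integrable lborel {0<..} (\<lambda>t::real. exp (- t / 2))"
    by (rule FTC(1)) simp
  show "(LINT t:{0<..}|lborel. exp (- t / 2)) = (2::real)"
    by (subst FTC(2)) simp_all
qed

text \<open>exp(-y) \<le> y^(-1/2) at y = x cosh t leaves an integrand of size exp(-t/2). K_0 is
  only logarithmic at 0, so a power below 1 suffices; this separates it from K_1, which is of order
  1/x.\<close>

lemma bessel_K_0_le_inverse_sqrt: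
  assumes "x > 0"
  shows "bessel_K 0 x \<le> 4 / sqrt x"
proof -
  have "bessel_K 0 x \<le> (LINT t:{0<..}|lborel. 2 / sqrt x * exp (- t / 2))"
    unfolding bessel_K_def
  proof (intro set_integral_mono set_integrable_bessel_K set_integrable_mult_right integral_exp_neg_half)
    fix t :: real
    assume "t \<in> {0<..}"
    define y where "y = x * cosh t"
    have "y > 0" using assms by (simp add: y_def)
    have "y \<le> exp y" using exp_ge_add_one_self[of y] by linarith
    also have "\<dots> \<le> (exp y)\<^sup>2" using \<open>y > 0\<close> by (simp add: power2_eq_square)
    finally have "sqrt y \<le> exp y" by (simp add: real_le_lsqrt)
    then have "exp (- y) \<le> 1 / sqrt y"
      using \<open>y > 0\<close> by (simp add: exp_minus field_simps)
    also have "\<dots> \<le> 2 / (sqrt x * exp (t / 2))"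
    proof -
      \<comment> \<open>The cruder constant 1/4 in place of 1/2 is a perfect square, so its root is
        1/2.\<close>
      have "x * exp t / 4 \<le> y"
        using assms by (simp add: y_def cosh_field_def)
      then have "sqrt (x * exp t / 4) \<le> sqrt y" by simp
      moreover have "exp t = (exp (t / 2))\<^sup>2"
        by (simp flip: exp_double)
      ultimately have "sqrt x * exp (t / 2) / 2 \<le> sqrt y"
        by (simp add: real_sqrt_mult real_sqrt_divide)
      then have "1 / sqrt y \<le> 1 / (sqrt x * exp (t / 2) / 2)"
        using assms \<open>y > 0\<close> by (intro divide_left_mono) auto
      then show ?thesis by simp
    qed
    finally show "exp (- x * cosh t) * cosh (real 0 * t) \<le> 2 / sqrt x * exp (- t / 2)"
      by (simp add: y_def exp_minus field_simps)
  qed (use assms in auto)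
  also have "\<dots> = 4 / sqrt x"
    by (simp only: set_integral_mult_right integral_exp_neg_half)
  finally show ?thesis .
qed

text \<open>Dominated convergence on a half line (c, \<infinity>) that contains x, with the majorant
  for the parameter c.\<close>

lemma isCont_bessel_K:
  assumes "\<nu> \<le> 1" "x > 0"
  shows "isCont (bessel_K \<nu>) x"
proof -
  define c where "c = x / 2"
  have c: "0 < c" "c < x" using assms by (auto simp: c_def)
  have "continuous_on {c<..} (bessel_K \<nu>)"
    unfolding continuous_on_sequentially comp_def
  proof (intro allI ballI impI, elim conjE)
    fix X a assume X: "\<forall>n. X n \<in> {c<..}" "X \<longlonglongrightarrow> a" and a: "a \<in> {c<..}"
    show "(\<lambda>n. bessel_K \<nu> (X n)) \<longlonglongrightarrow> bessel_K \<nu> a"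
      unfolding bessel_K_def set_lebesgue_integral_def
    proof (rule integral_dominated_convergence)
      show "integrable lborel (\<lambda>t. indicator {0<..} t *\<^sub>R (exp (- c * sinh t) * cosh t))"
        using integral_exp_sinh_cosh(1)[OF c(1)] by (simp add: set_integrable_def)
      have "set_borel_measurable lborel {0<..} (\<lambda>t. exp (- y * cosh t) * cosh (real \<nu> * t))" for y
        by (intro set_borel_measurable_continuous_Ioi continuous_intros)
      then show "(\<lambda>t. indicat_real {0<..} t *\<^sub>R (exp (- a * cosh t) * cosh (real \<nu> * t))) \<in> borel_measurable lborel"
        "(\<lambda>t. indicat_real {0<..} t *\<^sub>R (exp (- X n * cosh t) * cosh (real \<nu> * t))) \<in> borel_measurable lborel" for n
        unfolding set_borel_measurable_def by blast+
      show "AE t in lborel. (\<lambda>n. indicat_real {0<..} t *\<^sub>R (exp (- X n * cosh t) * cosh (real \<nu> * t)))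
          \<longlonglongrightarrow> indicat_real {0<..} t *\<^sub>R (exp (- a * cosh t) * cosh (real \<nu> * t))"
        by (intro AE_I2 tendsto_intros X)
      show "AE t in lborel. norm (indicat_real {0<..} t *\<^sub>R (exp (- X n * cosh t) * cosh (real \<nu> * t)))
          \<le> indicat_real {0<..} t *\<^sub>R (exp (- c * sinh t) * cosh t)" for n
        using bessel_K_integrand_le[OF assms(1) c(1), of "X n"] X(1)[rule_format, of n]
        by (intro AE_I2) (auto simp: indicator_def)
    qed
  qed
  then show ?thesis
    using c by (simp add: continuous_on_eq_continuous_at)
qed

subsection \<open>The interaction integrals\<close>

text \<open>The integral without its numerical factor, common to \<open>F_vv\<close> (orders 1, 1),
  \<open>F_ss\<close> (orders 0, 0) and \<open>F_vs\<close> (orders 0, 1).\<close>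

definition bessel_JKK :: "nat \<Rightarrow> nat \<Rightarrow> real \<Rightarrow> real \<Rightarrow> real" where
  "bessel_JKK \<mu> \<nu> \<alpha> l =
     (LINT \<xi>:{0<..}|lborel. \<xi>\<^sup>2 * bessel_J 0 (l * \<xi>) * bessel_K \<mu> (\<alpha> * \<xi>) * bessel_K \<nu> (\<xi> / \<alpha>))"

text \<open>Inverting \<alpha> exchanges the arguments of the two K factors.\<close>

lemma bessel_JKK_inverse: "bessel_JKK \<mu> \<nu> (inverse \<alpha>) l = bessel_JKK \<nu> \<mu> \<alpha> l"
proof -
  have "inverse \<alpha> * \<xi> = \<xi> / \<alpha>" "\<xi> / inverse \<alpha> = \<alpha> * \<xi>" for \<xi> :: real
    by (simp_all add: field_simps)
  then show ?thesis
    unfolding bessel_JKK_def by (simp only: mult.commute mult.left_commute mult.assoc)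
qed

section \<open>Pointwise majorants for the integrands\<close>

lemma integral_inverse_sqrt_weight:
  "set_integrable lborel {0<..} (\<lambda>\<xi>. 1 / (sqrt \<xi> * (1 + \<xi>)))"
  "(LINT \<xi>:{0<..}|lborel. 1 / (sqrt \<xi> * (1 + \<xi>))) = pi"
proof -
  have D: "((\<lambda>\<xi>. 2 * arctan (sqrt \<xi>)) has_real_derivative 1 / (sqrt \<xi> * (1 + \<xi>))) (at \<xi>)"
    if "\<xi> > 0" for \<xi> :: real
    using that by (auto intro!: derivative_eq_intros simp: divide_simps)
  have C: "isCont (\<lambda>\<xi>. 1 / (sqrt \<xi> * (1 + \<xi>))) \<xi>" if "\<xi> > 0" for \<xi> :: real
    using that by (intro continuous_intros) auto
  have lim0: "((\<lambda>\<xi>. 2 * arctan (sqrt \<xi>)) \<longlongrightarrow> 0) (at_right 0)"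
    by real_asymp
  have lim: "((\<lambda>\<xi>. 2 * arctan (sqrt \<xi>)) \<longlongrightarrow> pi) at_top"
    by real_asymp
  note FTC = integral_Ioi_FTC[OF D C _ lim0 lim]
  show "set_integrable lborel {0<..} (\<lambda>\<xi>. 1 / (sqrt \<xi> * (1 + \<xi>)))"
    by (rule FTC(1)) simp_all
  show "(LINT \<xi>:{0<..}|lborel. 1 / (sqrt \<xi> * (1 + \<xi>))) = pi"
    by (subst FTC(2)) simp_all
qed

text \<open>1 + \<xi> \<le> 2 max(1, \<xi>), so the weight dominates, up to the factor 2, the
  smaller of \<xi>^(-1/2) and \<xi>^(-3/2), which is integrable at both ends.\<close>

lemma le_inverse_sqrt_weight:
  fixes \<xi> c :: real
  assumes "\<xi> > 0" "c \<ge> 0" "y \<le> c / sqrt \<xi>" "y \<le> c / (\<xi> * sqrt \<xi>)"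
  shows "y \<le> 2 * c * (1 / (sqrt \<xi> * (1 + \<xi>)))"
proof (cases "\<xi> \<le> 1")
  case True
  have "c * (1 + \<xi>) \<le> c * 2"
    using True assms by (intro mult_left_mono) auto
  then have "c * (1 + \<xi>) / (sqrt \<xi> * (1 + \<xi>)) \<le> c * 2 / (sqrt \<xi> * (1 + \<xi>))"
    using assms by (intro divide_right_mono) auto
  then have "c / sqrt \<xi> \<le> 2 * c * (1 / (sqrt \<xi> * (1 + \<xi>)))"
    using assms by (simp add: mult.commute)
  then show ?thesis using assms by linarith
next
  case False
  have "c * (1 + \<xi>) \<le> c * (2 * \<xi>)"
    using False assms by (intro mult_left_mono) auto
  then have "c * (1 + \<xi>) / (\<xi> * sqrt \<xi> * (1 + \<xi>)) \<le> c * (2 * \<xi>) / (\<xi> * sqrt \<xi> * (1 + \<xi>))"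
    using assms by (intro divide_right_mono) auto
  then have "c / (\<xi> * sqrt \<xi>) \<le> 2 * c * (1 / (sqrt \<xi> * (1 + \<xi>)))"
    using assms by (simp add: mult_ac)
  then show ?thesis using assms by linarith
qed

text \<open>Applying the same power bound to both factors makes the estimate uniform in \<open>\<alpha>\<close>.\<close>
lemma bessel_KK_le:
  assumes "\<mu> \<le> 1" "\<nu> \<le> 1" "\<alpha> > 0" "\<xi> > 0"
  shows "\<xi>\<^sup>2 * (bessel_K \<mu> (\<alpha> * \<xi>) * bessel_K \<nu> (\<xi> / \<alpha>)) \<le> 32 * (1 / (sqrt \<xi> * (1 + \<xi>)))"
proof -
  let ?y = "\<xi>\<^sup>2 * (bessel_K \<mu> (\<alpha> * \<xi>) * bessel_K \<nu> (\<xi> / \<alpha>))"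
  have pos: "\<alpha> * \<xi> > 0" "\<xi> / \<alpha> > 0" using assms by auto
  have "?y \<le> \<xi>\<^sup>2 * (1 / (\<alpha> * \<xi>) * (1 / (\<xi> / \<alpha>)))"
    using assms pos by (intro mult_left_mono mult_mono bessel_K_le_inverse bessel_K_nonneg) auto
  also have "\<dots> = 1" using assms by (simp add: field_simps power2_eq_square)
  finally have y1: "?y \<le> 1" .
  have "?y \<le> \<xi>\<^sup>2 * (4 / (\<alpha> * \<xi>)\<^sup>2 * (4 / (\<xi> / \<alpha>)\<^sup>2))"
    using assms pos by (intro mult_left_mono mult_mono bessel_K_le_inverse_power bessel_K_nonneg) auto
  also have "\<dots> = 16 / \<xi>\<^sup>2" using assms by (simp add: field_simps power2_eq_square)
  finally have y2: "?y \<le> 16 / \<xi>\<^sup>2" .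
  \<comment> \<open>The bounds 1 and 16/\<xi>^2 are relaxed to the exponents 1/2 and 3/2 of the
    weight; the first one decides for \<xi> \<le> 1, the second one beyond.\<close>
  have "?y \<le> 16 / sqrt \<xi> \<and> ?y \<le> 16 / (\<xi> * sqrt \<xi>)"
  proof (cases "\<xi> \<le> 1")
    case True
    then have "sqrt \<xi> \<le> 1" using assms by simp
    moreover from this have "\<xi> * sqrt \<xi> \<le> 1 * 1"
      using True assms by (intro mult_mono) auto
    ultimately have "16 / sqrt \<xi> \<ge> 16" "16 / (\<xi> * sqrt \<xi>) \<ge> 16"
      using assms by (simp_all add: field_simps)
    then show ?thesis using y1 by linarith
  next
    case False
    then have s: "1 \<le> sqrt \<xi>" "sqrt \<xi> \<le> \<xi>"
      using assms by (auto simp: real_le_lsqrt power2_eq_square)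
    then have "\<xi> * sqrt \<xi> \<le> \<xi>\<^sup>2" "1 * sqrt \<xi> \<le> \<xi> * sqrt \<xi>"
      using False assms unfolding power2_eq_square by (intro mult_mono; simp)+
    then have "16 / \<xi>\<^sup>2 \<le> 16 / (\<xi> * sqrt \<xi>)" "16 / (\<xi> * sqrt \<xi>) \<le> 16 / sqrt \<xi>"
      using assms by (intro divide_left_mono; simp)+
    then show ?thesis using y2 by linarith
  qed
  then show ?thesis
    using le_inverse_sqrt_weight[OF assms(4), of 16 ?y] by simp
qed

text \<open>The bounds 4/x^2 and 16/x^3 for the factor at \<alpha>\<xi>, with 4/x^(1/2) for K_0 at
  \<xi>/\<alpha>, leave the powers \<alpha>^(-3/2) \<xi>^(-1/2) and \<alpha>^(-5/2) \<xi>^(-3/2).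
  Decay faster than 1/\<alpha> is what makes the interaction negligible at a vanishing
  radius.\<close>

lemma bessel_KK_0_le:
  assumes "\<mu> \<le> 1" "\<alpha> \<ge> 1" "\<xi> > 0"
  shows "\<xi>\<^sup>2 * (bessel_K \<mu> (\<alpha> * \<xi>) * bessel_K 0 (\<xi> / \<alpha>))
    \<le> 128 / (\<alpha> * sqrt \<alpha>) * (1 / (sqrt \<xi> * (1 + \<xi>)))"
proof -
  let ?y = "\<xi>\<^sup>2 * (bessel_K \<mu> (\<alpha> * \<xi>) * bessel_K 0 (\<xi> / \<alpha>))"
  define s where "s = sqrt \<xi>"
  define a where "a = sqrt \<alpha>"
  have sa: "s > 0" "a \<ge> 1" "\<xi> = s\<^sup>2" "\<alpha> = a\<^sup>2" "sqrt (\<xi> / \<alpha>) = s / a"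
    using assms by (auto simp: s_def a_def real_sqrt_divide)
  have pos: "\<alpha> * \<xi> > 0" "\<xi> / \<alpha> > 0" using assms by auto
  have "?y \<le> \<xi>\<^sup>2 * (4 / (\<alpha> * \<xi>)\<^sup>2 * (4 / sqrt (\<xi> / \<alpha>)))"
    using assms pos
    by (intro mult_left_mono mult_mono bessel_K_le_inverse_power bessel_K_0_le_inverse_sqrt bessel_K_nonneg) auto
  also have "\<dots> = 16 / (\<alpha> * a) / s"
    unfolding sa(5) using sa(1,2) assms by (simp add: sa(3,4) field_simps power2_eq_square)
  finally have y1: "?y \<le> 16 / (\<alpha> * a) / s" .
  have "?y \<le> \<xi>\<^sup>2 * (16 / (\<alpha> * \<xi>) ^ 3 * (4 / sqrt (\<xi> / \<alpha>)))"
    using assms pos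
    by (intro mult_left_mono mult_mono bessel_K_le_inverse_power bessel_K_0_le_inverse_sqrt bessel_K_nonneg) auto
  also have "\<dots> = 64 / (\<alpha> * a) / (\<xi> * s) / a\<^sup>2"
    unfolding sa(5) using sa(1,2) assms by (simp add: sa(3,4) field_simps power2_eq_square power3_eq_cube)
  \<comment> \<open>\<alpha> \<ge> 1 allows the surplus factor 1/\<alpha> = 1/a^2 to be
    dropped.\<close>
  also have "\<dots> \<le> 64 / (\<alpha> * a) / (\<xi> * s)"
  proof -
    have *: "X / a\<^sup>2 \<le> X" if "X \<ge> 0" for X
      using divide_left_mono[of 1 "a\<^sup>2" X] sa that by simp
    show ?thesis using sa(1,2) assms by (intro *) simp
  qed
  finally have y2: "?y \<le> 64 / (\<alpha> * a) / (\<xi> * s)" .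
  have "16 / (\<alpha> * a) / s \<le> 64 / (\<alpha> * a) / s"
    using sa assms by (intro divide_right_mono) auto
  then have "?y \<le> 64 / (\<alpha> * a) / s" using y1 by linarith
  moreover have "64 / (\<alpha> * a) \<ge> 0"
    using sa(2) assms(2) by simp
  ultimately have "?y \<le> 2 * (64 / (\<alpha> * a)) * (1 / (sqrt \<xi> * (1 + \<xi>)))"
    using le_inverse_sqrt_weight[OF assms(3)] y2 unfolding s_def by blast
  then show ?thesis unfolding a_def by simp
qed

lemma bessel_JKK_integrand_le:
  assumes "\<xi>\<^sup>2 * (bessel_K \<mu> (\<alpha> * \<xi>) * bessel_K \<nu> (\<xi> / \<alpha>)) \<le> B"
  shows "\<bar>\<xi>\<^sup>2 * bessel_J 0 (l * \<xi>) * bessel_K \<mu> (\<alpha> * \<xi>) * bessel_K \<nu> (\<xi> / \<alpha>)\<bar> \<le> B"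
proof -
  let ?y = "\<xi>\<^sup>2 * (bessel_K \<mu> (\<alpha> * \<xi>) * bessel_K \<nu> (\<xi> / \<alpha>))"
  have "?y \<ge> 0" by (intro mult_nonneg_nonneg bessel_K_nonneg) auto
  have "\<bar>\<xi>\<^sup>2 * bessel_J 0 (l * \<xi>) * bessel_K \<mu> (\<alpha> * \<xi>) * bessel_K \<nu> (\<xi> / \<alpha>)\<bar>
      = \<bar>bessel_J 0 (l * \<xi>)\<bar> * ?y"
    by (simp add: abs_mult bessel_K_nonneg)
  also have "\<dots> \<le> 1 * ?y"
    using \<open>?y \<ge> 0\<close> by (intro mult_right_mono abs_bessel_J_0_le_1)
  finally show ?thesis using assms by simp
qed

section \<open>Bounds and joint continuity of the interaction integrals\<close>

lemma set_borel_measurable_bessel_JKK: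
  assumes "\<mu> \<le> 1" "\<nu> \<le> 1" "\<alpha> > 0"
  shows "set_borel_measurable lborel {0<..}
    (\<lambda>\<xi>. \<xi>\<^sup>2 * bessel_J 0 (l * \<xi>) * bessel_K \<mu> (\<alpha> * \<xi>) * bessel_K \<nu> (\<xi> / \<alpha>))"
proof (intro set_borel_measurable_continuous_Ioi continuous_at_imp_continuous_on ballI continuous_mult)
  fix \<xi> :: real assume "\<xi> \<in> {0<..}"
  then show "isCont (\<lambda>\<xi>. bessel_K \<mu> (\<alpha> * \<xi>)) \<xi>" "isCont (\<lambda>\<xi>. bessel_K \<nu> (\<xi> / \<alpha>)) \<xi>"
    using assms
    by (intro isCont_o2[OF _ isCont_bessel_K, of _ "\<lambda>\<xi>. \<alpha> * \<xi>"]
        isCont_o2[OF _ isCont_bessel_K, of _ "\<lambda>\<xi>. \<xi> / \<alpha>"] continuous_intros; simp)+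
  show "isCont (\<lambda>\<xi>. bessel_J 0 (l * \<xi>)) \<xi>"
    by (intro isCont_o2[OF _ isCont_bessel_J_0] continuous_intros)
qed (intro continuous_intros)

text \<open>|J_0| \<le> 1 removes the oscillating factor, and the weight has integral pi.\<close>

lemma abs_bessel_JKK_le_integral:
  assumes "\<mu> \<le> 1" "\<nu> \<le> 1" "\<alpha> > 0"
    and le: "\<And>\<xi>. \<xi> > 0 \<Longrightarrow>
      \<xi>\<^sup>2 * (bessel_K \<mu> (\<alpha> * \<xi>) * bessel_K \<nu> (\<xi> / \<alpha>)) \<le> B * (1 / (sqrt \<xi> * (1 + \<xi>)))"
  shows "\<bar>bessel_JKK \<mu> \<nu> \<alpha> l\<bar> \<le> B * pi"
proof -
  have w: "set_integrable lborel {0<..} (\<lambda>\<xi>. B * (1 / (sqrt \<xi> * (1 + \<xi>))))"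
    by (intro set_integrable_mult_right integral_inverse_sqrt_weight)
  have "norm (bessel_JKK \<mu> \<nu> \<alpha> l) \<le> (LINT \<xi>:{0<..}|lborel. B * (1 / (sqrt \<xi> * (1 + \<xi>))))"
    unfolding bessel_JKK_def set_lebesgue_integral_def
  proof (rule Bochner_Integration.integral_norm_bound_integral)
    show "integrable lborel (\<lambda>\<xi>. indicat_real {0<..} \<xi> *\<^sub>R
        (\<xi>\<^sup>2 * bessel_J 0 (l * \<xi>) * bessel_K \<mu> (\<alpha> * \<xi>) * bessel_K \<nu> (\<xi> / \<alpha>)))"
      unfolding set_integrable_def[symmetric]
    proof (rule set_integrable_bound[OF w set_borel_measurable_bessel_JKK[OF assms(1-3)]])
      show "AE \<xi> in lborel. \<xi> \<in> {0<..} \<longrightarrow>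
          norm (\<xi>\<^sup>2 * bessel_J 0 (l * \<xi>) * bessel_K \<mu> (\<alpha> * \<xi>) * bessel_K \<nu> (\<xi> / \<alpha>))
          \<le> norm (B * (1 / (sqrt \<xi> * (1 + \<xi>))))"
        using order_trans[OF bessel_JKK_integrand_le[OF le] abs_ge_self]
        by (intro AE_I2 impI) (simp only: real_norm_def greaterThan_iff)
    qed
    show "integrable lborel (\<lambda>\<xi>. indicat_real {0<..} \<xi> *\<^sub>R (B * (1 / (sqrt \<xi> * (1 + \<xi>)))))"
      using w by (simp add: set_integrable_def)
  qed (use bessel_JKK_integrand_le[OF le] in \<open>auto simp: indicator_def\<close>)
  also have "\<dots> = B * pi"
    by (simp only: set_integral_mult_right integral_inverse_sqrt_weight)
  finally show ?thesis by simp
qed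

lemmas abs_bessel_JKK_le = abs_bessel_JKK_le_integral[OF _ _ _ bessel_KK_le]

lemma abs_bessel_JKK_0_le:
  assumes "\<mu> \<le> 1" "\<alpha> \<ge> 1"
  shows "\<bar>bessel_JKK \<mu> 0 \<alpha> l\<bar> \<le> 128 / (\<alpha> * sqrt \<alpha>) * pi"
  using assms by (intro abs_bessel_JKK_le_integral bessel_KK_0_le) auto

text \<open>Dominated convergence in both variables at once. The majorant, 32 times the weight,
  depends neither on \<alpha> nor on l, so no restriction to a neighbourhood is made.\<close>

lemma continuous_on_bessel_JKK:
  assumes "\<mu> \<le> 1" "\<nu> \<le> 1"
  shows "continuous_on ({0<..} \<times> UNIV) (\<lambda>(\<alpha>, l). bessel_JKK \<mu> \<nu> \<alpha> l)"
  unfolding continuous_on_sequentially comp_def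
proof (intro allI ballI impI, elim conjE)
  fix X :: "nat \<Rightarrow> real \<times> real" and p :: "real \<times> real"
  assume X: "\<forall>n. X n \<in> {0<..} \<times> UNIV" "X \<longlonglongrightarrow> p" and p: "p \<in> {0<..} \<times> UNIV"
  define f where "f = (\<lambda>(\<alpha>, l) \<xi>.
    \<xi>\<^sup>2 * bessel_J 0 (l * \<xi>) * bessel_K \<mu> (\<alpha> * \<xi>) * bessel_K \<nu> (\<xi> / \<alpha>))"
  have pos: "fst (X n) > 0" "fst p > 0" for n
    using X(1) p by (auto simp: mem_Times_iff)
  have "(\<lambda>n. LINT \<xi>:{0<..}|lborel. f (X n) \<xi>) \<longlonglongrightarrow> (LINT \<xi>:{0<..}|lborel. f p \<xi>)"
    unfolding set_lebesgue_integral_def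
  proof (rule integral_dominated_convergence)
    show "integrable lborel (\<lambda>\<xi>. indicator {0<..} \<xi> *\<^sub>R (32 * (1 / (sqrt \<xi> * (1 + \<xi>)))))"
      unfolding set_integrable_def[symmetric]
      by (intro set_integrable_mult_right integral_inverse_sqrt_weight)
    have "set_borel_measurable lborel {0<..} (f q)" if "fst q > 0" for q
      using set_borel_measurable_bessel_JKK[OF assms that, of "snd q"]
      by (simp add: f_def split_beta)
    then show "(\<lambda>\<xi>. indicat_real {0<..} \<xi> *\<^sub>R f p \<xi>) \<in> borel_measurable lborel"
      "(\<lambda>\<xi>. indicat_real {0<..} \<xi> *\<^sub>R f (X n) \<xi>) \<in> borel_measurable lborel" for n
      using pos unfolding set_borel_measurable_def by blast+
    have "(\<lambda>n. f (X n) \<xi>) \<longlonglongrightarrow> f p \<xi>" if "\<xi> > 0" for \<xi>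
      unfolding f_def split_beta
      by (intro tendsto_mult tendsto_const
          isCont_tendsto_compose[OF isCont_bessel_J_0] isCont_tendsto_compose[OF isCont_bessel_K]
          tendsto_divide tendsto_fst tendsto_snd X assms)
        (use pos that in \<open>auto simp: less_imp_neq[THEN not_sym]\<close>)
    then show "AE \<xi> in lborel. (\<lambda>n. indicat_real {0<..} \<xi> *\<^sub>R f (X n) \<xi>)
        \<longlonglongrightarrow> indicat_real {0<..} \<xi> *\<^sub>R f p \<xi>"
      by (intro AE_I2) (auto simp: indicator_def)
    show "AE \<xi> in lborel. norm (indicat_real {0<..} \<xi> *\<^sub>R f (X n) \<xi>)
        \<le> indicat_real {0<..} \<xi> *\<^sub>R (32 * (1 / (sqrt \<xi> * (1 + \<xi>))))" for n
      using bessel_JKK_integrand_le[OF bessel_KK_le[OF assms pos(1)]]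
      by (intro AE_I2) (auto simp: indicator_def f_def split_beta)
  qed
  then show "(\<lambda>n. case X n of (\<alpha>, l) \<Rightarrow> bessel_JKK \<mu> \<nu> \<alpha> l) \<longlonglongrightarrow> (case p of (\<alpha>, l) \<Rightarrow> bessel_JKK \<mu> \<nu> \<alpha> l)"
    by (simp add: bessel_JKK_def f_def split_beta)
qed

subsection \<open>Self energy and pair energy\<close>

text \<open>The prefactor is included because the product then extends continuously by 0 to a = 0 or
  b = 0. The divisions by zero that occur there are harmless, as the prefactor is 0.\<close>

definition pair_integral :: "nat \<Rightarrow> nat \<Rightarrow> real \<Rightarrow> real \<Rightarrow> real \<Rightarrow> real" where
  "pair_integral \<mu> \<nu> d a b = sqrt (a * b) * bessel_JKK \<mu> \<nu> (sqrt (b / a)) (d / sqrt (a * b))"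

lemma pair_integral_0 [simp]: "pair_integral \<mu> \<nu> d 0 b = 0" "pair_integral \<mu> \<nu> d a 0 = 0"
  by (simp_all add: pair_integral_def)

lemma pair_integral_commute: "pair_integral \<mu> \<nu> d a b = pair_integral \<nu> \<mu> d b a"
proof -
  have "inverse (sqrt (b / a)) = sqrt (a / b)"
    by (simp flip: real_sqrt_inverse)
  then show ?thesis
    unfolding pair_integral_def mult.commute[of b a]
    using bessel_JKK_inverse[of \<nu> \<mu> "sqrt (b / a)"] by simp
qed

lemma abs_pair_integral_le:
  assumes "\<mu> \<le> 1" "\<nu> \<le> 1" "a \<ge> 0" "b \<ge> 0"
  shows "\<bar>pair_integral \<mu> \<nu> d a b\<bar> \<le> 32 * pi * sqrt (a * b)"
proof (cases "a = 0 \<or> b = 0")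
  case False
  then have "\<bar>bessel_JKK \<mu> \<nu> (sqrt (b / a)) (d / sqrt (a * b))\<bar> \<le> 32 * pi"
    using assms by (intro abs_bessel_JKK_le) auto
  then have "sqrt (a * b) * \<bar>bessel_JKK \<mu> \<nu> (sqrt (b / a)) (d / sqrt (a * b))\<bar> \<le> sqrt (a * b) * (32 * pi)"
    using assms by (intro mult_left_mono) auto
  then show ?thesis
    using assms by (simp add: pair_integral_def abs_mult mult_ac)
qed auto

text \<open>At a vanishing radius the bound 32 pi sqrt(a b) squeezes the function to 0; elsewhere it
  is composed of continuous maps on an open quadrant.\<close>

lemma continuous_on_pair_integral:
  assumes "\<mu> \<le> 1" "\<nu> \<le> 1"
  shows "continuous_on ({0..} \<times> {0..}) (\<lambda>p. pair_integral \<mu> \<nu> d (fst p) (snd p))"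
  unfolding continuous_on_eq_continuous_within
proof
  let ?f = "\<lambda>p. pair_integral \<mu> \<nu> d (fst p) (snd p)"
  fix p :: "real \<times> real" assume p: "p \<in> {0..} \<times> {0..}"
  show "continuous (at p within {0..} \<times> {0..}) ?f"
  proof (cases "fst p = 0 \<or> snd p = 0")
    case True
    have lim: "((\<lambda>q. 32 * pi * sqrt (fst q * snd q)) \<longlongrightarrow> 32 * pi * sqrt (fst p * snd p))
        (at p within {0..} \<times> {0..})"
      by (intro tendsto_intros)
    have "(?f \<longlongrightarrow> 0) (at p within {0..} \<times> {0..})"
    proof (rule Lim_null_comparison)
      show "\<forall>\<^sub>F q in at p within {0..} \<times> {0..}. norm (?f q) \<le> 32 * pi * sqrt (fst q * snd q)"
        unfolding eventually_at_filter
        by (intro always_eventually) (auto intro!: abs_pair_integral_le assms simp: mem_Times_iff)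
      show "((\<lambda>q. 32 * pi * sqrt (fst q * snd q)) \<longlongrightarrow> 0) (at p within {0..} \<times> {0..})"
      proof -
        have "32 * pi * sqrt (fst p * snd p) = 0" using True by auto
        with lim show ?thesis by (simp only:)
      qed
    qed
    then show ?thesis
      using True by (auto simp: continuous_within)
  next
    case False
    have "continuous_on ({0<..} \<times> {0<..}) ?f"
      unfolding pair_integral_def
    proof (rule continuous_on_mult)
      show "continuous_on ({0<..} \<times> {0<..}) (\<lambda>p :: real \<times> real. sqrt (fst p * snd p))"
        by (intro continuous_intros)
      have "continuous_on ({0<..} \<times> {0<..})
          (\<lambda>p :: real \<times> real. (sqrt (snd p / fst p), d / sqrt (fst p * snd p)))"
        by (intro continuous_intros) (auto simp: mem_Times_iff)
      from continuous_on_compose2[OF continuous_on_bessel_JKK[OF assms] this]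
      show "continuous_on ({0<..} \<times> {0<..})
          (\<lambda>p. bessel_JKK \<mu> \<nu> (sqrt (snd p / fst p)) (d / sqrt (fst p * snd p)))"
        by (simp add: image_subset_iff mem_Times_iff)
    qed
    moreover have "open ({0<..} \<times> {0<..} :: (real \<times> real) set)"
      by (intro open_Times) auto
    moreover have "p \<in> {0<..} \<times> {0<..}"
      using p False by (auto simp: mem_Times_iff)
    ultimately have "isCont ?f p"
      using continuous_on_eq_continuous_at by blast
    then show ?thesis by (rule continuous_at_imp_continuous_at_within)
  qed
qed

text \<open>With \<alpha> = sqrt(b/\<epsilon>), the prefactor divided by \<epsilon> is exactly
  \<alpha>, while the integral is O(\<alpha>^(-3/2)). The order 0 of the second K factor supplies
  this decay.\<close>

lemma pair_integral_little_o:
  assumes "\<mu> \<le> 1" "b \<ge> 0"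
  shows "((\<lambda>\<epsilon>. pair_integral \<mu> 0 d \<epsilon> b / \<epsilon>) \<longlongrightarrow> 0) (at_right 0)"
proof (cases "b = 0")
  case False
  then have b: "b > 0" using assms by simp
  show ?thesis
  proof (rule Lim_null_comparison)
    show "((\<lambda>\<epsilon>. 128 * pi / sqrt (sqrt (b / \<epsilon>))) \<longlongrightarrow> 0) (at_right 0)"
      using b by real_asymp
    show "\<forall>\<^sub>F \<epsilon> in at_right 0. norm (pair_integral \<mu> 0 d \<epsilon> b / \<epsilon>) \<le> 128 * pi / sqrt (sqrt (b / \<epsilon>))"
      using eventually_at_right_less[of 0] eventually_at_right_real[OF b]
    proof eventually_elim
      case (elim \<epsilon>)
      define \<alpha> where "\<alpha> = sqrt (b / \<epsilon>)"
      have \<alpha>: "\<alpha> \<ge> 1" using elim by (simp add: \<alpha>_def)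
      have "sqrt (\<epsilon> * b) / \<epsilon> = sqrt \<epsilon> * sqrt b / (sqrt \<epsilon> * sqrt \<epsilon>)"
        using elim by (simp add: real_sqrt_mult)
      also have "\<dots> = \<alpha>"
        using elim unfolding \<alpha>_def real_sqrt_divide by (intro mult_divide_mult_cancel_left) simp
      finally have s: "sqrt (\<epsilon> * b) / \<epsilon> = \<alpha>" .
      have "norm (pair_integral \<mu> 0 d \<epsilon> b / \<epsilon>)
          = sqrt (\<epsilon> * b) / \<epsilon> * \<bar>bessel_JKK \<mu> 0 \<alpha> (d / sqrt (\<epsilon> * b))\<bar>"
        using elim by (simp add: pair_integral_def abs_mult \<alpha>_def)
      also have "\<dots> = \<alpha> * \<bar>bessel_JKK \<mu> 0 \<alpha> (d / sqrt (\<epsilon> * b))\<bar>"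
        unfolding s ..
      also have "\<dots> \<le> \<alpha> * (128 / (\<alpha> * sqrt \<alpha>) * pi)"
        using \<alpha> assms by (intro mult_left_mono abs_bessel_JKK_0_le) auto
      also have "\<dots> = 128 * pi / sqrt \<alpha>"
        using \<alpha> by simp
      finally show ?case by (simp add: \<alpha>_def)
    qed
  qed
qed auto

text \<open>All constants combine to 8 pi: (pi^3/4) 3 (32/(3 pi^2)) = (pi^3/4) (32/pi^2) = 4 pi 2.
  The arguments \<open>s\<close> and \<open>t\<close> stand for the two cosines.\<close>

definition pair_energy :: "real \<Rightarrow> real \<Rightarrow> real \<Rightarrow> real \<Rightarrow> real \<Rightarrow> real" where
  "pair_energy d a b s t = 8 * pi * (s * t * pair_integral 1 1 d a b - pair_integral 0 0 d a b
     - s * pair_integral 0 1 d a b + t * pair_integral 1 0 d a b)"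

definition self_energy :: "real \<Rightarrow> real \<Rightarrow> real \<Rightarrow> real \<Rightarrow> real" where
  "self_energy \<delta> \<kappa> a c = - 4 * pi * a\<^sup>2 * ln (exp (1 + 2 * euler_mascheroni) / 4 * a\<^sup>2)
     - 8 * pi * \<kappa> * a * c + \<delta> * (pi ^ 3 / 8) * a * (3 * c\<^sup>2 - 1)"

text \<open>The angles enter only through their cosines. As free variables these range over the
  compact interval [-1, 1], whereas [-pi, pi) is not compact.\<close>

definition cos_energy ::
  "real \<Rightarrow> real \<Rightarrow> nat \<Rightarrow> (nat \<Rightarrow> real ^ 2) \<Rightarrow> (nat \<Rightarrow> real) \<Rightarrow> (nat \<Rightarrow> real) \<Rightarrow> real"
where
  "cos_energy \<delta> \<kappa> N r \<rho> c = (\<Sum>n=1..N. self_energy \<delta> \<kappa> (\<rho> n) (c n))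
     + \<delta> * (\<Sum>n=1..N-1. \<Sum>k=n+1..N. pair_energy (norm (r n - r k)) (\<rho> n) (\<rho> k) (c n) (c k))"

lemma energy_eq_cos_energy: "energy \<delta> \<kappa> N \<rho> \<theta> r = cos_energy \<delta> \<kappa> N r \<rho> (\<lambda>n. cos (\<theta> n))"
proof -
  have F: "sqrt (a * b) * F_vv (sqrt (b / a)) (d / sqrt (a * b)) = 32 / (3 * pi\<^sup>2) * pair_integral 1 1 d a b"
    "sqrt (a * b) * F_ss (sqrt (b / a)) (d / sqrt (a * b)) = 32 / pi\<^sup>2 * pair_integral 0 0 d a b"
    "sqrt (a * b) * F_vs (sqrt (b / a)) (d / sqrt (a * b)) = 2 * pair_integral 0 1 d a b"
    "sqrt (a * b) * F_vs (inverse (sqrt (b / a))) (d / sqrt (a * b)) = 2 * pair_integral 1 0 d a b" for a b d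
    unfolding pair_integral_def bessel_JKK_inverse[symmetric, of 1 0]
    by (simp_all add: F_vv_def F_ss_def F_vs_def bessel_JKK_def)
  have "\<delta> * (pi ^ 3 / 4) * sqrt (a * b) * (3 * s * t * F_vv (sqrt (b / a)) (d / sqrt (a * b))
        - F_ss (sqrt (b / a)) (d / sqrt (a * b)))
      - 4 * pi * \<delta> * sqrt (a * b) * (s * F_vs (sqrt (b / a)) (d / sqrt (a * b))
        - t * F_vs (inverse (sqrt (b / a))) (d / sqrt (a * b)))
      = \<delta> * pair_energy d a b s t" (is "?lhs = _") for a b d s t
  proof -
    have "?lhs = \<delta> * (pi ^ 3 / 4) * (3 * s * t * (sqrt (a * b) * F_vv (sqrt (b / a)) (d / sqrt (a * b)))
        - sqrt (a * b) * F_ss (sqrt (b / a)) (d / sqrt (a * b)))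
      - 4 * pi * \<delta> * (s * (sqrt (a * b) * F_vs (sqrt (b / a)) (d / sqrt (a * b)))
        - t * (sqrt (a * b) * F_vs (inverse (sqrt (b / a))) (d / sqrt (a * b))))"
      by (simp add: algebra_simps)
    also have "\<dots> = \<delta> * pair_energy d a b s t"
      unfolding F pair_energy_def by (simp add: field_simps power2_eq_square power3_eq_cube)
    finally show ?thesis .
  qed
  then show ?thesis
    unfolding energy_def cos_energy_def self_energy_def pair_alpha_def pair_lambda_def
    by (simp add: sum_distrib_left flip: sum_subtractf add_diff_eq)
qed

text \<open>Four terms of size at most 32 pi R each, times 8 pi. The bound does not involve the
  distance \<open>d\<close>, hence no condition on the positions arises later.\<close>

lemma abs_pair_energy_le:
  assumes "0 \<le> a" "a \<le> R" "0 \<le> b" "b \<le> R" "\<bar>s\<bar> \<le> 1" "\<bar>t\<bar> \<le> 1"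
  shows "\<bar>pair_energy d a b s t\<bar> \<le> 1024 * pi\<^sup>2 * R"
proof -
  have "sqrt (a * b) \<le> sqrt (R * R)"
    using assms by (intro real_sqrt_le_mono mult_mono) auto
  then have le: "32 * pi * sqrt (a * b) \<le> 32 * pi * R"
    using assms by (intro mult_left_mono) auto
  have P: "\<bar>x * pair_integral \<mu> \<nu> d a b\<bar> \<le> 32 * pi * R" if "\<mu> \<le> 1" "\<nu> \<le> 1" "\<bar>x\<bar> \<le> 1" for \<mu> \<nu> x
  proof -
    have *: "\<bar>pair_integral \<mu> \<nu> d a b\<bar> \<le> 32 * pi * R"
      using abs_pair_integral_le[OF that(1,2) assms(1,3)] le by (rule order_trans)
    show ?thesis
      using mult_mono[OF that(3) *] by (simp add: abs_mult)
  qed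
  have st: "\<bar>s * t\<bar> \<le> 1"
    using assms by (simp add: abs_mult mult_le_one)
  have "\<bar>s * t * pair_integral 1 1 d a b - pair_integral 0 0 d a b
     - s * pair_integral 0 1 d a b + t * pair_integral 1 0 d a b\<bar> \<le> 128 * pi * R"
    using P[of 1 1 "s * t"] P[of 0 0 1] P[of 0 1 s] P[of 1 0 t] st assms by simp
  then have "8 * pi * \<bar>s * t * pair_integral 1 1 d a b - pair_integral 0 0 d a b
     - s * pair_integral 0 1 d a b + t * pair_integral 1 0 d a b\<bar> \<le> 8 * pi * (128 * pi * R)"
    by (intro mult_left_mono) auto
  then show ?thesis
    unfolding pair_energy_def by (simp add: abs_mult power2_eq_square mult_ac)
qed

text \<open>Setting the cosine of the shrinking skyrmion to 0 leaves only integrals of the kind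
  covered by \<open>pair_integral_little_o\<close>. Both slots are treated because pairs are
  ordered; the second reduces to the first by symmetry.\<close>

lemma pair_energy_little_o:
  assumes "b \<ge> 0"
  shows "((\<lambda>\<epsilon>. pair_energy d \<epsilon> b 0 t / \<epsilon>) \<longlongrightarrow> 0) (at_right 0)"
    and "((\<lambda>\<epsilon>. pair_energy d b \<epsilon> t 0 / \<epsilon>) \<longlongrightarrow> 0) (at_right 0)"
proof -
  have 1: "pair_energy d \<epsilon> b 0 t / \<epsilon> =
      8 * pi * (t * (pair_integral 1 0 d \<epsilon> b / \<epsilon>) - pair_integral 0 0 d \<epsilon> b / \<epsilon>)" for \<epsilon>
    by (simp add: pair_energy_def diff_divide_distrib algebra_simps)
  have 2: "pair_energy d b \<epsilon> t 0 / \<epsilon> =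
      8 * pi * (- t * (pair_integral 1 0 d \<epsilon> b / \<epsilon>) - pair_integral 0 0 d \<epsilon> b / \<epsilon>)" for \<epsilon>
    unfolding pair_energy_def pair_integral_commute[of 0 _ d b]
    by (simp add: diff_divide_distrib algebra_simps)
  have *: "((\<lambda>\<epsilon>. 8 * pi * (s * (pair_integral 1 0 d \<epsilon> b / \<epsilon>) - pair_integral 0 0 d \<epsilon> b / \<epsilon>))
      \<longlongrightarrow> 8 * pi * (s * 0 - 0)) (at_right 0)" for s
    by (intro tendsto_intros pair_integral_little_o assms) auto
  show "((\<lambda>\<epsilon>. pair_energy d \<epsilon> b 0 t / \<epsilon>) \<longlongrightarrow> 0) (at_right 0)"
    unfolding 1 using *[of t] by simp
  show "((\<lambda>\<epsilon>. pair_energy d b \<epsilon> t 0 / \<epsilon>) \<longlongrightarrow> 0) (at_right 0)"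
    unfolding 2 using *[of "- t"] by simp
qed

section \<open>The self energy near radius 0 and below the critical radius\<close>

lemma self_energy_0 [simp]: "self_energy \<delta> \<kappa> 0 c = 0"
  by (simp add: self_energy_def)

lemma pair_energy_0 [simp]: "pair_energy d 0 b s t = 0" "pair_energy d a 0 s t = 0"
  by (simp_all add: pair_energy_def)

text \<open>\<epsilon>^2 ln \<epsilon> is o(\<epsilon>) and a cosine 0 removes the \<kappa> term, so
  only the anisotropy with 3 c^2 - 1 = -1 is left.\<close>

lemma self_energy_at_0:
  "((\<lambda>\<epsilon>. self_energy \<delta> \<kappa> \<epsilon> 0 / \<epsilon>) \<longlongrightarrow> - (\<delta> * pi ^ 3 / 8)) (at_right 0)"
proof -
  define C :: real where "C = exp (1 + 2 * euler_mascheroni) / 4"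
  have "C > 0" by (simp add: C_def)
  then have "((\<lambda>\<epsilon>. (- 4 * pi * \<epsilon>\<^sup>2 * ln (C * \<epsilon>\<^sup>2) - \<delta> * (pi ^ 3 / 8) * \<epsilon>) / \<epsilon>) \<longlongrightarrow> - (\<delta> * pi ^ 3 / 8)) (at_right 0)"
    by real_asymp
  then show ?thesis by (simp add: self_energy_def flip: C_def)
qed

text \<open>The bound on a is 1/L for the critical L = exp(2 + \<gamma>)/2. There the logarithm
  equals -3, the source of 12 pi = 4 pi 3; for smaller a it is lower still.\<close>

lemma self_energy_ge:
  assumes "0 \<le> a" "a \<le> 2 * exp (- 2 - euler_mascheroni)" "\<bar>c\<bar> \<le> 1" "0 \<le> \<delta>"
  shows "self_energy \<delta> \<kappa> a c \<ge> 12 * pi * a\<^sup>2 - (8 * pi * \<bar>\<kappa>\<bar> + \<delta> * pi ^ 3 / 8) * a"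
proof (cases "a = 0")
  case False
  define C :: real where "C = exp (1 + 2 * euler_mascheroni) / 4"
  have "C * a\<^sup>2 \<le> C * (2 * exp (- 2 - euler_mascheroni))\<^sup>2"
    using assms by (intro mult_left_mono power_mono) (auto simp: C_def)
  also have "\<dots> = exp (1 + 2 * euler_mascheroni) * exp (2 * (- 2 - euler_mascheroni))"
    by (simp add: C_def power_mult_distrib flip: exp_double)
  also have "\<dots> = exp (- 3)"
    by (subst mult_exp_exp) simp
  finally have "ln (C * a\<^sup>2) \<le> ln (exp (- 3))"
    using False by (subst ln_le_cancel_iff) (auto simp: C_def)
  then have "12 * pi * a\<^sup>2 \<le> - 4 * pi * a\<^sup>2 * ln (C * a\<^sup>2)"
    using mult_left_mono[of "ln (C * a\<^sup>2)" "- 3" "4 * pi * a\<^sup>2"] by simp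
  moreover have "\<kappa> * c \<le> \<bar>\<kappa>\<bar>"
    using abs_le_D1[of "\<kappa> * c" "\<bar>\<kappa>\<bar>"] mult_left_mono[OF assms(3), of "\<bar>\<kappa>\<bar>"] by (simp add: abs_mult)
  then have "8 * pi * a * (\<kappa> * c) \<le> 8 * pi * a * \<bar>\<kappa>\<bar>"
    using assms by (intro mult_left_mono) auto
  moreover have "\<delta> * (pi ^ 3 / 8) * a * (- 1) \<le> \<delta> * (pi ^ 3 / 8) * a * (3 * c\<^sup>2 - 1)"
    using assms by (intro mult_left_mono) auto
  moreover have "8 * pi * \<kappa> * a * c = 8 * pi * a * (\<kappa> * c)"
    "(8 * pi * \<bar>\<kappa>\<bar> + \<delta> * pi ^ 3 / 8) * a = 8 * pi * a * \<bar>\<kappa>\<bar> - \<delta> * (pi ^ 3 / 8) * a * (- 1)"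
    by (simp_all add: algebra_simps)
  ultimately show ?thesis
    unfolding self_energy_def C_def[symmetric] by linarith
qed simp

section \<open>Continuity up to radius 0\<close>

lemma continuous_on_square_times_ln_square:
  fixes C :: real
  assumes "C > 0"
  shows "continuous_on {0..} (\<lambda>a. a\<^sup>2 * ln (C * a\<^sup>2))"
  unfolding continuous_on_eq_continuous_within
proof
  fix a :: real assume a: "a \<in> {0..}"
  show "continuous (at a within {0..}) (\<lambda>a. a\<^sup>2 * ln (C * a\<^sup>2))"
  proof (cases "a = 0")
    case True
    \<comment> \<open>At 0 the function vanishes through the factor a^2, so the limit 0 is its
      value.\<close>
    have "((\<lambda>a. a\<^sup>2 * ln (C * a\<^sup>2)) \<longlongrightarrow> 0) (at_right 0)"
      using assms by real_asymp
    then show ?thesis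
      using True by (simp add: continuous_within at_within_Ici_at_right)
  next
    case False
    then show ?thesis
      using assms by (intro continuous_intros) auto
  qed
qed

lemma continuous_on_self_energy:
  assumes "continuous_on S f" "continuous_on S g" "\<And>x. x \<in> S \<Longrightarrow> f x \<ge> 0"
  shows "continuous_on S (\<lambda>x. self_energy \<delta> \<kappa> (f x) (g x))"
proof -
  define C :: real where "C = exp (1 + 2 * euler_mascheroni) / 4"
  have "C > 0" by (simp add: C_def)
  have L: "continuous_on S (\<lambda>x. (f x)\<^sup>2 * ln (C * (f x)\<^sup>2))"
    by (rule continuous_on_compose2[OF continuous_on_square_times_ln_square[OF \<open>C > 0\<close>] assms(1)])
      (use assms(3) in auto)
  have "continuous_on S (\<lambda>x. - 4 * pi * ((f x)\<^sup>2 * ln (C * (f x)\<^sup>2))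
      - 8 * pi * \<kappa> * f x * g x + \<delta> * (pi ^ 3 / 8) * f x * (3 * (g x)\<^sup>2 - 1))"
    by (intro continuous_on_add continuous_on_diff continuous_on_mult_left[OF L];
        intro continuous_intros assms(1,2))
  then show ?thesis by (simp add: self_energy_def C_def mult.assoc)
qed

lemma continuous_on_pair_energy:
  assumes "continuous_on S f" "continuous_on S g" "continuous_on S u" "continuous_on S v"
    and "\<And>x. x \<in> S \<Longrightarrow> f x \<ge> 0" "\<And>x. x \<in> S \<Longrightarrow> g x \<ge> 0"
  shows "continuous_on S (\<lambda>x. pair_energy d (f x) (g x) (u x) (v x))"
proof -
  have "continuous_on S (\<lambda>x. pair_integral \<mu> \<nu> d (f x) (g x))" if "\<mu> \<le> 1" "\<nu> \<le> 1" for \<mu> \<nu>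
    using continuous_on_compose2[OF continuous_on_pair_integral[OF that, of d]
        continuous_on_Pair[OF assms(1,2)]] assms(5,6) by auto
  then show ?thesis
    unfolding pair_energy_def by (intro continuous_intros assms) auto
qed

subsection \<open>Existence of a minimizer\<close>

text \<open>Tychonoff's theorem. Families are functions on all of \<open>nat\<close>, so every
  coordinate is confined, including the indices outside \<open>{1..N}\<close>.\<close>

lemma compact_real_fun_box: "compact {f :: nat \<Rightarrow> real. \<forall>n. f n \<in> {a..b}}"
proof -
  have "compactin (product_topology (\<lambda>_. euclidean) UNIV) (PiE UNIV (\<lambda>_ :: nat. {a..b}))"
    by (simp add: compactin_PiE)
  moreover have "PiE UNIV (\<lambda>_. {a..b}) = {f :: nat \<Rightarrow> real. \<forall>n. f n \<in> {a..b}}"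
    by (auto simp: PiE_def Pi_def)
  ultimately show ?thesis
    by (simp only: euclidean_product_topology compactin_euclidean_iff)
qed

text \<open>The interaction vanishes as a radius tends to \<open>0\<close>, in agreement with the junk value of
  the formula at radius \<open>0\<close>; hence the energy is continuous up to that part of the boundary.\<close>
lemma cos_energy_attains_inf:
  assumes "R \<ge> 0"
  obtains \<rho> c where "\<And>n. \<rho> n \<in> {0..R}" "\<And>n. c n \<in> {-1..1}"
    "\<And>\<rho>' c'. (\<And>n. \<rho>' n \<in> {0..R}) \<Longrightarrow> (\<And>n. c' n \<in> {-1..1}) \<Longrightarrow>
       cos_energy \<delta> \<kappa> N r \<rho> c \<le> cos_energy \<delta> \<kappa> N r \<rho>' c'"
proof -
  define A where "A = {f :: nat \<Rightarrow> real. \<forall>n. f n \<in> {0..R}}"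
  define B where "B = {f :: nat \<Rightarrow> real. \<forall>n. f n \<in> {-1..1}}"
  have fst: "continuous_on (A \<times> B) (\<lambda>p. fst p n)" for n
    by (rule continuous_on_product_then_coordinatewise) (intro continuous_intros)
  have snd: "continuous_on (A \<times> B) (\<lambda>p. snd p n)" for n
    by (rule continuous_on_product_then_coordinatewise) (intro continuous_intros)
  have "continuous_on (A \<times> B) (\<lambda>p. cos_energy \<delta> \<kappa> N r (fst p) (snd p))"
    unfolding cos_energy_def
    by (intro continuous_on_add continuous_on_mult_left continuous_on_sum continuous_on_self_energy
        continuous_on_pair_energy fst snd) (auto simp: A_def mem_Times_iff)
  moreover have "compact (A \<times> B)"
    unfolding A_def B_def by (intro compact_Times compact_real_fun_box)
  moreover have "((\<lambda>_. 0), (\<lambda>_. 0)) \<in> A \<times> B"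
    using assms by (simp add: A_def B_def)
  ultimately obtain p where p: "p \<in> A \<times> B"
    "\<And>q. q \<in> A \<times> B \<Longrightarrow> cos_energy \<delta> \<kappa> N r (fst p) (snd p) \<le> cos_energy \<delta> \<kappa> N r (fst q) (snd q)"
    using continuous_attains_inf[of "A \<times> B" "\<lambda>p. cos_energy \<delta> \<kappa> N r (fst p) (snd p)"] by blast
  show thesis
  proof (rule that)
    show "fst p n \<in> {0..R}" "snd p n \<in> {-1..1}" for n
      using p(1) by (auto simp: A_def B_def mem_Times_iff)
    fix \<rho>' c' :: "nat \<Rightarrow> real"
    assume "\<And>n. \<rho>' n \<in> {0..R}" "\<And>n. c' n \<in> {-1..1}"
    then show "cos_energy \<delta> \<kappa> N r (fst p) (snd p) \<le> cos_energy \<delta> \<kappa> N r \<rho>' c'"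
      using p(2)[of "(\<rho>', c')"] by (simp add: A_def B_def)
  qed
qed

text \<open>To leading order in \<open>\<epsilon>\<close> every interaction of the new skyrmion carries the factor \<open>cos \<theta> m\<close>,
  so with \<open>cos \<theta> m = 0\<close> only the negative anisotropy term survives.\<close>
lemma cos_energy_insert_small:
  assumes m: "m \<in> {1..N}" "\<rho> m = 0" and nonneg: "\<And>n. \<rho> n \<ge> 0"
  shows "((\<lambda>\<epsilon>. (cos_energy \<delta> \<kappa> N r (\<rho>(m := \<epsilon>)) (c(m := 0)) - cos_energy \<delta> \<kappa> N r \<rho> c) / \<epsilon>)
    \<longlongrightarrow> - (\<delta> * pi ^ 3 / 8)) (at_right 0)"
proof -
  define s where "s = (\<lambda>\<epsilon> n. (self_energy \<delta> \<kappa> ((\<rho>(m := \<epsilon>)) n) ((c(m := 0)) n) - self_energy \<delta> \<kappa> (\<rho> n) (c n)) / \<epsilon>)"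
  define w where "w = (\<lambda>\<epsilon> n k. (pair_energy (norm (r n - r k)) ((\<rho>(m := \<epsilon>)) n) ((\<rho>(m := \<epsilon>)) k)
      ((c(m := 0)) n) ((c(m := 0)) k) - pair_energy (norm (r n - r k)) (\<rho> n) (\<rho> k) (c n) (c k)) / \<epsilon>)"
  have "((\<lambda>\<epsilon>. s \<epsilon> n) \<longlongrightarrow> (if n = m then - (\<delta> * pi ^ 3 / 8) else 0)) (at_right 0)" for n
    using self_energy_at_0[of \<delta> \<kappa>] by (auto simp: s_def m)
  then have S: "((\<lambda>\<epsilon>. \<Sum>n=1..N. s \<epsilon> n) \<longlongrightarrow> (\<Sum>n=1..N. if n = m then - (\<delta> * pi ^ 3 / 8) else 0)) (at_right 0)"
    by (rule tendsto_sum)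
  have "((\<lambda>\<epsilon>. w \<epsilon> n k) \<longlongrightarrow> 0) (at_right 0)" if "n < k" for n k
  proof -
    \<comment> \<open>n < k excludes n = k = m, so at most one radius of each pair is
      perturbed.\<close>
    consider "n = m" "k \<noteq> m" | "k = m" "n \<noteq> m" | "n \<noteq> m" "k \<noteq> m" using \<open>n < k\<close> by blast
    then show ?thesis
    proof cases
      case 1
      then show ?thesis using pair_energy_little_o(1)[OF nonneg] by (simp add: w_def m)
    next
      case 2
      then show ?thesis using pair_energy_little_o(2)[OF nonneg] by (simp add: w_def m)
    next
      case 3
      then show ?thesis by (simp add: w_def)
    qed
  qed
  then have "((\<lambda>\<epsilon>. \<delta> * (\<Sum>n=1..N-1. \<Sum>k=n+1..N. w \<epsilon> n k)) \<longlongrightarrow> \<delta> * (\<Sum>n=1..N-1. \<Sum>k=n+1..N. 0)) (at_right 0)"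
    by (intro tendsto_mult tendsto_const tendsto_sum) auto
  from tendsto_add[OF S this]
  have "((\<lambda>\<epsilon>. (\<Sum>n=1..N. s \<epsilon> n) + \<delta> * (\<Sum>n=1..N-1. \<Sum>k=n+1..N. w \<epsilon> n k)) \<longlongrightarrow> - (\<delta> * pi ^ 3 / 8)) (at_right 0)"
    using m(1) by simp
  moreover have "(cos_energy \<delta> \<kappa> N r (\<rho>(m := \<epsilon>)) (c(m := 0)) - cos_energy \<delta> \<kappa> N r \<rho> c) / \<epsilon>
      = (\<Sum>n=1..N. s \<epsilon> n) + \<delta> * (\<Sum>n=1..N-1. \<Sum>k=n+1..N. w \<epsilon> n k)" for \<epsilon>
    unfolding cos_energy_def s_def w_def
    by (simp only: sum_subtractf flip: sum_divide_distrib)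
      (simp only: diff_divide_distrib add_divide_distrib algebra_simps times_divide_eq_right)
  ultimately show ?thesis by (simp only:)
qed

text \<open>The self and pair bounds are summed, with \<open>\<delta>\<^sub>0\<close> in place of
  both \<delta> and |\<kappa>|. The right-hand side is free of the positions, so the threshold
  derived from it is uniform in them.\<close>

lemma cos_energy_ge:
  assumes "0 \<le> R" "R \<le> 2 * exp (- 2 - euler_mascheroni)" "0 \<le> \<delta>" "\<delta> \<le> \<delta>\<^sub>0" "\<bar>\<kappa>\<bar> \<le> \<delta>\<^sub>0"
    and \<rho>: "\<And>n. \<rho> n \<in> {0..R}" and c: "\<And>n. c n \<in> {-1..1}"
  shows "cos_energy \<delta> \<kappa> N r \<rho> c \<ge> (\<Sum>n=1..N. 12 * pi * (\<rho> n)\<^sup>2)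
    - \<delta>\<^sub>0 * (real N * ((8 * pi + pi ^ 3 / 8) * R) + (\<Sum>n=1..N-1. \<Sum>k=n+1..N. 1024 * pi\<^sup>2 * R))"
proof -
  have "12 * pi * (\<rho> n)\<^sup>2 - \<delta>\<^sub>0 * ((8 * pi + pi ^ 3 / 8) * R) \<le> self_energy \<delta> \<kappa> (\<rho> n) (c n)" for n
  proof -
    have "(8 * pi * \<bar>\<kappa>\<bar> + \<delta> * pi ^ 3 / 8) * \<rho> n \<le> (8 * pi * \<delta>\<^sub>0 + \<delta>\<^sub>0 * pi ^ 3 / 8) * R"
      using assms(1-5) \<rho>[of n] by (intro mult_mono add_mono mult_left_mono divide_right_mono) auto
    moreover have "self_energy \<delta> \<kappa> (\<rho> n) (c n)
        \<ge> 12 * pi * (\<rho> n)\<^sup>2 - (8 * pi * \<bar>\<kappa>\<bar> + \<delta> * pi ^ 3 / 8) * \<rho> n"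
      using assms(1-5) \<rho>[of n] c[of n] by (intro self_energy_ge) auto
    ultimately show ?thesis by (simp add: algebra_simps)
  qed
  then have "(\<Sum>n=1..N. 12 * pi * (\<rho> n)\<^sup>2 - \<delta>\<^sub>0 * ((8 * pi + pi ^ 3 / 8) * R))
      \<le> (\<Sum>n=1..N. self_energy \<delta> \<kappa> (\<rho> n) (c n))"
    by (intro sum_mono)
  then have self: "(\<Sum>n=1..N. 12 * pi * (\<rho> n)\<^sup>2) - \<delta>\<^sub>0 * (real N * ((8 * pi + pi ^ 3 / 8) * R))
      \<le> (\<Sum>n=1..N. self_energy \<delta> \<kappa> (\<rho> n) (c n))"
    by (simp add: sum_subtractf mult_ac)
  define P where "P = (\<Sum>n=1..N-1. \<Sum>k=n+1..N. 1024 * pi\<^sup>2 * R)"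
  have "\<bar>pair_energy (norm (r n - r k)) (\<rho> n) (\<rho> k) (c n) (c k)\<bar> \<le> 1024 * pi\<^sup>2 * R" for n k
    using \<rho>[of n] \<rho>[of k] c[of n] c[of k] by (intro abs_pair_energy_le) (auto simp: abs_le_iff)
  then have "- (1024 * pi\<^sup>2 * R) \<le> pair_energy (norm (r n - r k)) (\<rho> n) (\<rho> k) (c n) (c k)" for n k
    by (metis abs_le_iff minus_le_iff)
  then have "(\<Sum>n=1..N-1. \<Sum>k=n+1..N. - (1024 * pi\<^sup>2 * R))
      \<le> (\<Sum>n=1..N-1. \<Sum>k=n+1..N. pair_energy (norm (r n - r k)) (\<rho> n) (\<rho> k) (c n) (c k))"
    by (intro sum_mono)
  then have "- P \<le> (\<Sum>n=1..N-1. \<Sum>k=n+1..N. pair_energy (norm (r n - r k)) (\<rho> n) (\<rho> k) (c n) (c k))"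
    by (simp only: P_def sum_negf)
  then have "\<delta> * (- P) \<le> \<delta> * (\<Sum>n=1..N-1. \<Sum>k=n+1..N. pair_energy (norm (r n - r k)) (\<rho> n) (\<rho> k) (c n) (c k))"
    using assms(3) by (rule mult_left_mono)
  moreover have "P \<ge> 0"
    unfolding P_def using assms(1) by (intro sum_nonneg) auto
  then have "\<delta> * P \<le> \<delta>\<^sub>0 * P"
    using assms(4) by (intro mult_right_mono)
  ultimately show ?thesis
    using self unfolding cos_energy_def P_def[symmetric] distrib_left by linarith
qed

theorem theorem1:
  fixes N :: nat and L\<^sub>0 :: real
  assumes "N \<ge> 1" and "L\<^sub>0 > 1 / 2 * exp (2 + euler_mascheroni)"
  shows "\<exists>\<delta>\<^sub>0>0. \<forall>(r :: nat \<Rightarrow> real ^ 2) (\<delta> :: real) (\<kappa> :: real).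
           0 < \<delta> \<and> \<delta> < \<delta>\<^sub>0 \<and> \<bar>\<kappa>\<bar> < \<delta>\<^sub>0 \<longrightarrow>
           (\<exists>\<rho> \<theta>. admissible L\<^sub>0 N \<rho> \<theta> \<and>
              (\<forall>\<rho>' \<theta>'. admissible L\<^sub>0 N \<rho>' \<theta>' \<longrightarrow>
                 energy \<delta> \<kappa> N \<rho> \<theta> r \<le> energy \<delta> \<kappa> N \<rho>' \<theta>' r))"
proof -
  define R where "R = inverse L\<^sub>0"
  have "L\<^sub>0 > 0"
    using assms(2) by (rule less_trans[rotated]) simp
  then have "R > 0" by (simp add: R_def)
  have "inverse L\<^sub>0 \<le> inverse (1 / 2 * exp (2 + euler_mascheroni))"
    using assms(2) by (intro le_imp_inverse_le) auto
  also have "\<dots> = 2 * exp (- (2 + euler_mascheroni))"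
    unfolding exp_minus by (simp add: inverse_eq_divide)
  finally have R: "R \<le> 2 * exp (- 2 - euler_mascheroni)"
    by (simp add: R_def)
  define M where "M = real N * ((8 * pi + pi ^ 3 / 8) * R) + (\<Sum>n=1..N-1. \<Sum>k=n+1..N. 1024 * pi\<^sup>2 * R)"
  have "M > 0"
    unfolding M_def using \<open>R > 0\<close> assms(1)
    by (intro add_pos_nonneg sum_nonneg mult_pos_pos add_pos_pos) auto
  \<comment> \<open>With this choice the error term \<open>\<delta>\<^sub>0 * M\<close> of
    \<open>cos_energy_ge\<close> is 6 pi R^2, half of what a single radius R contributes.\<close>
  define \<delta>\<^sub>0 where "\<delta>\<^sub>0 = 6 * pi * R\<^sup>2 / M"
  have "\<delta>\<^sub>0 > 0" using \<open>M > 0\<close> \<open>R > 0\<close> by (simp add: \<delta>\<^sub>0_def)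
  have "\<exists>\<rho> \<theta>. admissible L\<^sub>0 N \<rho> \<theta> \<and>
      (\<forall>\<rho>' \<theta>'. admissible L\<^sub>0 N \<rho>' \<theta>' \<longrightarrow> energy \<delta> \<kappa> N \<rho> \<theta> r \<le> energy \<delta> \<kappa> N \<rho>' \<theta>' r)"
    if \<delta>: "0 < \<delta>" "\<delta> < \<delta>\<^sub>0" "\<bar>\<kappa>\<bar> < \<delta>\<^sub>0" for r :: "nat \<Rightarrow> real ^ 2" and \<delta> \<kappa>
  proof -
    obtain \<rho> c where \<rho>: "\<And>n. \<rho> n \<in> {0..R}" and c: "\<And>n. c n \<in> {-1..1}"
      and min: "\<And>\<rho>' c'. (\<And>n. \<rho>' n \<in> {0..R}) \<Longrightarrow> (\<And>n. c' n \<in> {-1..1}) \<Longrightarrow>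
        cos_energy \<delta> \<kappa> N r \<rho> c \<le> cos_energy \<delta> \<kappa> N r \<rho>' c'"
      using cos_energy_attains_inf[of R \<delta> \<kappa> N r] \<open>R > 0\<close> by (metis less_imp_le)
    have pos: "\<rho> m \<noteq> 0" if m: "m \<in> {1..N}" for m
    proof
      assume "\<rho> m = 0"
      \<comment> \<open>Raising \<open>\<rho> m\<close> to a small \<epsilon> with cosine 0 stays in
        the box, so minimality makes the difference quotients nonnegative, although their limit is
        negative.\<close>
      have "- (\<delta> * pi ^ 3 / 8) \<ge> 0"
      proof (rule tendsto_lowerbound)
        show "((\<lambda>\<epsilon>. (cos_energy \<delta> \<kappa> N r (\<rho>(m := \<epsilon>)) (c(m := 0)) - cos_energy \<delta> \<kappa> N r \<rho> c) / \<epsilon>)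
            \<longlongrightarrow> - (\<delta> * pi ^ 3 / 8)) (at_right 0)"
          using \<rho> by (intro cos_energy_insert_small m \<open>\<rho> m = 0\<close>) auto
        show "\<forall>\<^sub>F \<epsilon> in at_right 0.
            0 \<le> (cos_energy \<delta> \<kappa> N r (\<rho>(m := \<epsilon>)) (c(m := 0)) - cos_energy \<delta> \<kappa> N r \<rho> c) / \<epsilon>"
          using eventually_at_right_real[OF \<open>R > 0\<close>]
        proof eventually_elim
          case (elim \<epsilon>)
          have "cos_energy \<delta> \<kappa> N r \<rho> c \<le> cos_energy \<delta> \<kappa> N r (\<rho>(m := \<epsilon>)) (c(m := 0))"
            using elim \<rho> c by (intro min) auto
          then show ?case using elim by simp
        qed
      qed auto
      moreover have "\<delta> * pi ^ 3 > 0" using \<delta>(1) by simp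
      ultimately show False by simp
    qed
    have less: "\<rho> m \<noteq> R" if m: "m \<in> {1..N}" for m
    proof
      assume "\<rho> m = R"
      have "12 * pi * R\<^sup>2 \<le> (\<Sum>n=1..N. 12 * pi * (\<rho> n)\<^sup>2)"
        using member_le_sum[of m "{1..N}" "\<lambda>n. 12 * pi * (\<rho> n)\<^sup>2"] m \<open>\<rho> m = R\<close> by simp
      also have "\<dots> \<le> cos_energy \<delta> \<kappa> N r \<rho> c + \<delta>\<^sub>0 * M"
      proof -
        have "(\<Sum>n=1..N. 12 * pi * (\<rho> n)\<^sup>2) - \<delta>\<^sub>0 * M \<le> cos_energy \<delta> \<kappa> N r \<rho> c"
          unfolding M_def using \<open>R > 0\<close> R \<delta> \<rho> c by (intro cos_energy_ge) auto
        then show ?thesis by linarith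
      qed
      \<comment> \<open>The configuration with all radii 0 is a competitor in the closed
        box.\<close>
      also have "cos_energy \<delta> \<kappa> N r \<rho> c \<le> cos_energy \<delta> \<kappa> N r (\<lambda>_. 0) (\<lambda>_. 0)"
        using \<open>R > 0\<close> by (intro min) auto
      also have "\<dots> = 0" by (simp add: cos_energy_def)
      also have "0 + \<delta>\<^sub>0 * M = 6 * pi * R\<^sup>2"
        using \<open>M > 0\<close> by (simp add: \<delta>\<^sub>0_def)
      finally have "12 * pi * R\<^sup>2 \<le> 6 * pi * R\<^sup>2" by simp
      moreover have "pi * R\<^sup>2 > 0" using \<open>R > 0\<close> by simp
      ultimately show False by linarith
    qed
    \<comment> \<open>arccos has values in [0, pi]; the minus sign moves them into [-pi, pi), which
      contains -pi but not pi.\<close>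
    define \<theta> where "\<theta> = (\<lambda>n. - arccos (c n))"
    have cos: "(\<lambda>n. cos (\<theta> n)) = c"
      using c by (auto simp: \<theta>_def)
    have "0 \<le> arccos (c n)" "arccos (c n) \<le> pi" for n
      using c[of n] by (auto intro: arccos_lbound arccos_ubound)
    then have "\<theta> n \<in> {-pi..<pi}" for n
      using pi_gt_zero unfolding \<theta>_def atLeastLessThan_iff
      by (smt (verit))
    then have "admissible L\<^sub>0 N \<rho> \<theta>"
      using \<rho> pos less unfolding admissible_def R_def[symmetric]
      by (force simp: less_le)
    moreover have "energy \<delta> \<kappa> N \<rho> \<theta> r \<le> energy \<delta> \<kappa> N \<rho>' \<theta>' r" if "admissible L\<^sub>0 N \<rho>' \<theta>'" for \<rho>' \<theta>'
    proof -
      \<comment> \<open>Admissibility says nothing about indices outside \<open>{1..N}\<close>;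
        radii 0 there put the competitor into the box without changing its energy.\<close>
      define \<rho>'' where "\<rho>'' = (\<lambda>n. if n \<in> {1..N} then \<rho>' n else 0)"
      have "cos_energy \<delta> \<kappa> N r \<rho> c \<le> cos_energy \<delta> \<kappa> N r \<rho>'' (\<lambda>n. cos (\<theta>' n))"
        using that \<open>R > 0\<close>
        by (intro min) (auto simp: \<rho>''_def admissible_def less_imp_le simp flip: R_def)
      also have "\<dots> = cos_energy \<delta> \<kappa> N r \<rho>' (\<lambda>n. cos (\<theta>' n))"
        unfolding cos_energy_def
        by (intro arg_cong2[of _ _ _ _ "(+)"] arg_cong2[of _ _ _ _ "(*)"] sum.cong refl) (auto simp: \<rho>''_def)
      finally show ?thesis by (simp add: energy_eq_cos_energy cos)
    qed
    ultimately show ?thesis by blast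
  qed
  with \<open>\<delta>\<^sub>0 > 0\<close> show ?thesis by blast
qed

end
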